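(* Let $p$ be a prime and let $k,n$ be nonnegative integers. (1) If $p=3$, then $B_{3}(3^kn+3^k-1)=3^{2k}B_{3}(n)$. (2) If $p\equiv 1 \pmod 3$ and $p\nmid n+1$, then \[B_{3}(p^kn+p^k-1)=\frac{p^{2(k+1)}-1}{p^2-1}B_{3}(n).\] (3) If $p\equiv 2 \pmod 3$ and $p\nmid n+1$, then \[B_{3}(p^kn+p^k-1)=\frac{p^{2(k+1)}+(-1)^k}{p^2+1}B_{3}(n).\]
   Context: A partition $\lambda$ of a nonnegative integer is called a $3$-core if none of its hook lengths is divisible by $3$. $B_3(n)$ denotes the number of ordered triples $(\lambda_1,\lambda_2,\lambda_3)$ of partitions, each a $3$-core, whose sizes sum to $n$; equivalently $\sum_{n\ge0}B_3(n)q^n=\frac{(q^3;q^3)_\infty^{9}}{(q;q)_\infty^{3}}$, where $(a;q)_\infty=\prod_{k\ge0}(1-aq^k)$. *)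

theory Defs
  imports Complex_Main "HOL-Computational_Algebra.Primes"
begin

definition is_partition :: "nat list \<Rightarrow> bool" where
  "is_partition xs \<longleftrightarrow> sorted_wrt (\<ge>) xs \<and> (\<forall>x\<in>set xs. 0 < x)"

definition psize :: "nat list \<Rightarrow> nat" where
  "psize xs = sum_list xs"

definition conj_part :: "nat list \<Rightarrow> nat \<Rightarrow> nat" where
  "conj_part xs j = length (filter (\<lambda>r. j < r) xs)"

text \<open>Hook length of the cell in row i, column j (0-based), for j < xs!i.\<close>
definition hook_length :: "nat list \<Rightarrow> nat \<Rightarrow> nat \<Rightarrow> nat" where
  "hook_length xs i j = (xs ! i - j) + (conj_part xs j - i) - 1"

definition is_t_core :: "nat \<Rightarrow> nat list \<Rightarrow> bool" where
  "is_t_core t xs \<longleftrightarrow> is_partition xs \<and>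
     (\<forall>i < length xs. \<forall>j < xs ! i. \<not> t dvd hook_length xs i j)"

definition B3 :: "nat \<Rightarrow> nat" where
  "B3 n = card {(a, b, c). is_t_core 3 a \<and> is_t_core 3 b \<and> is_t_core 3 c \<and>
                          psize a + psize b + psize c = n}"

end

theory Submission
  imports Defs "HOL-Number_Theory.Residue_Primitive_Roots" "HOL-Library.Discrete_Functions"
begin

text \<open>
  Everything follows from the formula that B3 n is the sum of d^2 chi(N/d) over the divisors d of
  N = n + 1, where chi is the nontrivial character modulo 3.

  The beta-set of a 3-core is closed under subtracting 3, so a 3-core is a pair (a, b) of natural
  numbers, and its size is a^2 - ab + b^2 + b. Up to the action of the six units, these pairs are the
  Eisenstein integers of norm 9m + 3. Comparing the two recurrences at a prime p shows that there are
  6 D(n) Eisenstein integers of norm n, where D(n) is the sum of chi(d) over the divisors d of n;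
  so there are D(3m + 1) 3-cores of size m.

  It remains to evaluate the sum of D(l) D(m) D(n) over l + m + n = 3N with l, m, n congruent to 1
  modulo 3. Writing D(m) as a signed count of the integer factorizations m = a x with a and x
  congruent to 1 modulo 3 turns products of values of D into sums over solutions of a x + b y = M
  with a x, b y > 0. The sign sg a x of such a factorization satisfies the combinatorial form of the
  Fay identity,
    sg a x * sg b y = sg (a + b) x * sg b (y - x) + sg (a + b) y * sg a (x - y)
  off the diagonals x = y and a = -b. Summing it against suitable weights, the generic terms cancel
  by the symmetries of the equation, and the diagonals give divisor sums.
\<close>

section \<open>Hyperbolic sums\<close>

text \<open>The obstacle is that a product of three values of D involves three factorizations at
  once, while the Fay identity splits only two. Pairs are therefore evaluated separately: for M = 2
  mod 3 the sum of D(l) D(m) over l + m = M collapses to one third of the ordinary divisor sum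
  sigma(M). Written as a sum of |c| over signed factorizations c x = M with c = 2 and x = 1 mod 3,
  sigma(M) is again a sum the identity accepts, now with weight b instead of 1. Signs are essential.
  Negating both factors when they are 2 mod 3 puts all factorizations into one residue class, and
  the substitutions mix a with b, so they do not preserve positivity. For triples the generic terms
  do not all cancel. What survives has a and y divisible by 3, hence descends from 3N to N, where a
  second use of the identity evaluates it. The quotients in the theorem are geometric sums: at p the
  divisor sum has the local parameters p^2 and chi(p), so the factor p^k contributes (p^(2(k+1)) -
  chi(p)^(k+1)) / (p^2 - chi(p)).\<close>

definition quad :: "int \<Rightarrow> (int \<times> int \<times> int \<times> int) set" where
  "quad M = {(a, b, x, y). a * x > 0 \<and> b * y > 0 \<and> a * x + b * y = M}"

lemma abs_le_mult_pos:
  fixes a x :: int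
  assumes "a * x > 0"
  shows "\<bar>a\<bar> \<le> a * x" "\<bar>x\<bar> \<le> a * x"
proof -
  have nz: "a \<noteq> 0" "x \<noteq> 0" using assms by auto
  have "a * x = \<bar>a\<bar> * \<bar>x\<bar>" using assms by (simp flip: abs_mult)
  moreover have "1 \<le> \<bar>a\<bar>" "1 \<le> \<bar>x\<bar>" using nz by auto
  ultimately show "\<bar>a\<bar> \<le> a * x" "\<bar>x\<bar> \<le> a * x"
    using mult_left_mono[of 1 "\<bar>x\<bar>" "\<bar>a\<bar>"] mult_right_mono[of 1 "\<bar>a\<bar>" "\<bar>x\<bar>"] by auto
qed

lemma finite_quad [simp]: "finite (quad M)"
proof (rule finite_subset)
  show "quad M \<subseteq> {-M..M} \<times> {-M..M} \<times> {-M..M} \<times> {-M..M}"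
  proof
    fix t assume t: "t \<in> quad M"
    obtain a b x y where [simp]: "t = (a, b, x, y)" by (metis prod_cases4)
    have "a * x > 0" "b * y > 0" "a * x + b * y = M" using t by (auto simp: quad_def)
    with abs_le_mult_pos[of a x] abs_le_mult_pos[of b y]
    have "\<bar>a\<bar> \<le> M" "\<bar>b\<bar> \<le> M" "\<bar>x\<bar> \<le> M" "\<bar>y\<bar> \<le> M" by linarith+
    then show "t \<in> {-M..M} \<times> {-M..M} \<times> {-M..M} \<times> {-M..M}" by auto
  qed
qed auto

text \<open>Equal to \<open>sgn a\<close> where the product is positive and truncated to 0
  elsewhere, so that a sum over \<open>quad M\<close> can be extended to a larger set of solutions
  on which substitutions act freely.\<close>

definition sg :: "int \<Rightarrow> int \<Rightarrow> int" where
  "sg a x = (if a * x > 0 then sgn a else 0)"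

lemma sg_eq: "sg a x = (if a > 0 \<and> x > 0 then 1 else if a < 0 \<and> x < 0 then -1 else 0)"
  by (auto simp: sg_def zero_less_mult_iff)

text \<open>For a, b > 0 this cuts the quadrant x, y > 0 along its diagonal; the other signs are
  similar case checks. On x = y or a = -b both generic products vanish, since \<open>sg\<close> is 0
  at a zero argument, so the conditional terms must restore the left-hand side. The last hypothesis
  keeps it from being restored twice.\<close>

lemma sg_three_term:
  fixes a b x y :: int
  assumes "a \<noteq> 0" "b \<noteq> 0" "x \<noteq> 0" "y \<noteq> 0" "x \<noteq> y \<or> a \<noteq> - b"
  shows "sg a x * sg b y = (if x = y then sg a x * sg b y else 0) + (if a = - b then sg a x * sg b y else 0)
      + sg (a + b) x * sg b (y - x) + sg (a + b) y * sg a (x - y)"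
proof -
  consider "a > 0" "b > 0" | "a > 0" "b < 0" | "a < 0" "b > 0" | "a < 0" "b < 0"
    using assms by linarith
  then show ?thesis
    by cases (use assms in \<open>auto simp: sg_eq\<close>)
qed

lemma sum_quad_sg:
  "(\<Sum>(a, b, x, y)\<in>quad M. sgn a * sgn b * g a b x y) = (\<Sum>(a, b, x, y)\<in>quad M. sg a x * sg b y * g a b x y)"
  by (rule sum.cong) (auto simp: quad_def sg_def)

text \<open>Summation of the three-term identity against g, followed by the inverse substitutions,
  which preserve a x + b y. The identity can fail at a zero coordinate, hence the vanishing
  condition on g; both diagonals at once would force M = 0.\<close>

lemma quad_split:
  fixes g :: "int \<Rightarrow> int \<Rightarrow> int \<Rightarrow> int \<Rightarrow> int"
  assumes M: "M \<noteq> 0"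
    and g: "\<And>a b x y. a = 0 \<or> b = 0 \<or> x = 0 \<or> y = 0 \<Longrightarrow> g a b x y = 0"
  shows "(\<Sum>(a, b, x, y)\<in>quad M. sgn a * sgn b * g a b x y) =
      (\<Sum>(a, b, x, y)\<in>quad M. if x = y then sgn a * sgn b * g a b x y else 0)
    + (\<Sum>(a, b, x, y)\<in>quad M. if a = - b then sgn a * sgn b * g a b x y else 0)
    + (\<Sum>(a, b, x, y)\<in>quad M. sgn a * sgn b * g (a - b) b x (x + y))
    + (\<Sum>(a, b, x, y)\<in>quad M. sgn a * sgn b * g b (a - b) (x + y) x)"
proof -
  \<comment> \<open>the inverses of the two substitutions in sg_three_term\<close>
  define p1 :: "int \<times> int \<times> int \<times> int \<Rightarrow> int \<times> int \<times> int \<times> int"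
    where "p1 = (\<lambda>(a, b, x, y). (a - b, b, x, x + y))"
  define p2 :: "int \<times> int \<times> int \<times> int \<Rightarrow> int \<times> int \<times> int \<times> int"
    where "p2 = (\<lambda>(a, b, x, y). (b, a - b, x + y, x))"
  \<comment> \<open>Each product of signs is supported, among solutions of the equation, on one of
    these three sets. The identity can thus be summed pointwise over one finite set, and each
    resulting sum then restricted to its own support.\<close>
  define R where "R = quad M \<union> p1 ` quad M \<union> p2 ` quad M"
  have inj: "inj p1" "inj p2" by (auto simp: p1_def p2_def inj_on_def)
  have fin: "finite R" by (simp add: R_def)
  have eqM: "a * x + b * y = M" if "(a, b, x, y) \<in> R" for a b x y
    using that by (auto simp: R_def p1_def p2_def quad_def algebra_simps)
  have S0: "(\<Sum>(a, b, x, y)\<in>R. sg a x * sg b y * h a b x y) = (\<Sum>(a, b, x, y)\<in>quad M. sgn a * sgn b * h a b x y)"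
    for h
  proof -
    have "(\<Sum>(a, b, x, y)\<in>quad M. sgn a * sgn b * h a b x y) = (\<Sum>(a, b, x, y)\<in>quad M. sg a x * sg b y * h a b x y)"
      by (rule sum_quad_sg)
    also have "\<dots> = (\<Sum>(a, b, x, y)\<in>R. sg a x * sg b y * h a b x y)"
    proof (rule sum.mono_neutral_left[OF fin])
      show "quad M \<subseteq> R" by (auto simp: R_def)
      show "\<forall>t\<in>R - quad M. (case t of (a, b, x, y) \<Rightarrow> sg a x * sg b y * h a b x y) = 0"
      proof
        fix t assume t: "t \<in> R - quad M"
        obtain a b x y where [simp]: "t = (a, b, x, y)" by (metis prod_cases4)
        have "a * x + b * y = M" using eqM t by simp
        then show "(case t of (a, b, x, y) \<Rightarrow> sg a x * sg b y * h a b x y) = 0"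
          using t by (auto simp: quad_def sg_def)
      qed
    qed
    finally show ?thesis by simp
  qed
  have S1: "(\<Sum>(a, b, x, y)\<in>R. sg (a + b) x * sg b (y - x) * g a b x y)
      = (\<Sum>(a, b, x, y)\<in>quad M. sgn a * sgn b * g (a - b) b x (x + y))"
  proof -
    have "(\<Sum>(a, b, x, y)\<in>R. sg (a + b) x * sg b (y - x) * g a b x y)
        = (\<Sum>(a, b, x, y)\<in>p1 ` quad M. sg (a + b) x * sg b (y - x) * g a b x y)"
    proof (rule sum.mono_neutral_right[OF fin])
      show "p1 ` quad M \<subseteq> R" by (auto simp: R_def)
      show "\<forall>t\<in>R - p1 ` quad M. (case t of (a, b, x, y) \<Rightarrow> sg (a + b) x * sg b (y - x) * g a b x y) = 0"
      proof
        fix t assume t: "t \<in> R - p1 ` quad M"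
        obtain a b x y where [simp]: "t = (a, b, x, y)" by (metis prod_cases4)
        have "t = p1 (a + b, b, x, y - x)" by (simp add: p1_def)
        then have "(a + b, b, x, y - x) \<notin> quad M" using t by blast
        moreover have "(a + b) * x + b * (y - x) = M" using eqM t by (auto simp: algebra_simps)
        ultimately show "(case t of (a, b, x, y) \<Rightarrow> sg (a + b) x * sg b (y - x) * g a b x y) = 0"
          by (auto simp: quad_def sg_def)
      qed
    qed
    also have "\<dots> = (\<Sum>(a, b, x, y)\<in>quad M. sg a x * sg b y * g (a - b) b x (x + y))"
      by (subst sum.reindex) (use inj in \<open>auto simp: p1_def inj_on_def intro!: sum.cong\<close>)
    finally show ?thesis by (simp add: sum_quad_sg)
  qed
  have S2: "(\<Sum>(a, b, x, y)\<in>R. sg (a + b) y * sg a (x - y) * g a b x y)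
      = (\<Sum>(a, b, x, y)\<in>quad M. sgn a * sgn b * g b (a - b) (x + y) x)"
  proof -
    have "(\<Sum>(a, b, x, y)\<in>R. sg (a + b) y * sg a (x - y) * g a b x y)
        = (\<Sum>(a, b, x, y)\<in>p2 ` quad M. sg (a + b) y * sg a (x - y) * g a b x y)"
    proof (rule sum.mono_neutral_right[OF fin])
      show "p2 ` quad M \<subseteq> R" by (auto simp: R_def)
      show "\<forall>t\<in>R - p2 ` quad M. (case t of (a, b, x, y) \<Rightarrow> sg (a + b) y * sg a (x - y) * g a b x y) = 0"
      proof
        fix t assume t: "t \<in> R - p2 ` quad M"
        obtain a b x y where [simp]: "t = (a, b, x, y)" by (metis prod_cases4)
        have "t = p2 (a + b, a, y, x - y)" by (simp add: p2_def)
        then have "(a + b, a, y, x - y) \<notin> quad M" using t by blast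
        moreover have "(a + b) * y + a * (x - y) = M" using eqM t by (auto simp: algebra_simps)
        ultimately show "(case t of (a, b, x, y) \<Rightarrow> sg (a + b) y * sg a (x - y) * g a b x y) = 0"
          by (auto simp: quad_def sg_def)
      qed
    qed
    also have "\<dots> = (\<Sum>(a, b, x, y)\<in>quad M. sg a x * sg b y * g b (a - b) (x + y) x)"
      by (subst sum.reindex) (use inj in \<open>auto simp: p2_def inj_on_def intro!: sum.cong\<close>)
    finally show ?thesis by (simp add: sum_quad_sg)
  qed
  have "(\<Sum>(a, b, x, y)\<in>quad M. sgn a * sgn b * g a b x y) = (\<Sum>(a, b, x, y)\<in>R. sg a x * sg b y * g a b x y)"
    by (simp add: S0)
  also have "\<dots> = (\<Sum>(a, b, x, y)\<in>R. sg a x * sg b y * (if x = y then g a b x y else 0)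
      + sg a x * sg b y * (if a = - b then g a b x y else 0)
      + sg (a + b) x * sg b (y - x) * g a b x y + sg (a + b) y * sg a (x - y) * g a b x y)"
  proof (rule sum.cong[OF refl], safe)
    fix a b x y assume "(a, b, x, y) \<in> R"
    then have M0: "a * x + b * y \<noteq> 0" using eqM M by auto
    show "sg a x * sg b y * g a b x y = sg a x * sg b y * (if x = y then g a b x y else 0)
      + sg a x * sg b y * (if a = - b then g a b x y else 0)
      + sg (a + b) x * sg b (y - x) * g a b x y + sg (a + b) y * sg a (x - y) * g a b x y"
    proof (cases "a = 0 \<or> b = 0 \<or> x = 0 \<or> y = 0")
      case True
      have "(if x = y then g a b x y else 0) = 0" "(if a = - b then g a b x y else 0) = 0"
        using g[OF True] by auto
      then show ?thesis using g[OF True] by (simp only: mult_zero_right add_0_right)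
    next
      case False
      then have "sg a x * sg b y * g a b x y = ((if x = y then sg a x * sg b y else 0) + (if a = - b then sg a x * sg b y else 0)
      + sg (a + b) x * sg b (y - x) + sg (a + b) y * sg a (x - y)) * g a b x y"
        using sg_three_term[of a b x y] M0 by force
      then show ?thesis by (simp add: distrib_right)
    qed
  qed
  also have "\<dots> = (\<Sum>(a, b, x, y)\<in>R. sg a x * sg b y * (if x = y then g a b x y else 0))
      + (\<Sum>(a, b, x, y)\<in>R. sg a x * sg b y * (if a = - b then g a b x y else 0))
      + (\<Sum>(a, b, x, y)\<in>R. sg (a + b) x * sg b (y - x) * g a b x y)
      + (\<Sum>(a, b, x, y)\<in>R. sg (a + b) y * sg a (x - y) * g a b x y)"
    by (simp add: case_prod_unfold sum.distrib)
  finally show ?thesis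
    unfolding S0 S1 S2 by (simp only: mult_zero_right if_distrib)
qed

section \<open>Symmetries of the equation a x + b y = M\<close>

lemma sum_quad_transpose:
  "(\<Sum>(a, b, x, y)\<in>quad M. f a b x y) = (\<Sum>(a, b, x, y)\<in>quad M. f x y a b)"
  by (rule sum.reindex_bij_witness[where i = "\<lambda>(a, b, x, y). (x, y, a, b)" and j = "\<lambda>(a, b, x, y). (x, y, a, b)"])
    (auto simp: quad_def mult.commute)

lemma sum_quad_neg_snd:
  "(\<Sum>(a, b, x, y)\<in>quad M. f a b x y) = (\<Sum>(a, b, x, y)\<in>quad M. f a (- b) x (- y))"
  by (rule sum.reindex_bij_witness[where i = "\<lambda>(a, b, x, y). (a, - b, x, - y)" and j = "\<lambda>(a, b, x, y). (a, - b, x, - y)"])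
    (auto simp: quad_def)

lemma sum_quad_transpose_snd:
  "(\<Sum>(a, b, x, y)\<in>quad M. f a b x y) = (\<Sum>(a, b, x, y)\<in>quad M. f a y x b)"
  by (rule sum.reindex_bij_witness[where i = "\<lambda>(a, b, x, y). (a, y, x, b)" and j = "\<lambda>(a, b, x, y). (a, y, x, b)"])
    (auto simp: quad_def mult.commute)

lemma sum_quad_swap:
  "(\<Sum>(a, b, x, y)\<in>quad M. f a b x y) = (\<Sum>(a, b, x, y)\<in>quad M. f b a y x)"
  by (rule sum.reindex_bij_witness[where i = "\<lambda>(a, b, x, y). (b, a, y, x)" and j = "\<lambda>(a, b, x, y). (b, a, y, x)"])
    (auto simp: quad_def)

lemma sum_quad_cong:
  assumes "\<And>a b x y. a * x > 0 \<Longrightarrow> b * y > 0 \<Longrightarrow> sgn x = sgn a \<Longrightarrow> sgn y = sgn b \<Longrightarrow> a * x + b * y = M \<Longrightarrow> f a b x y = g a b x y"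
  shows "(\<Sum>(a, b, x, y)\<in>quad M. f a b x y) = (\<Sum>(a, b, x, y)\<in>quad M. g a b x y)"
proof (rule sum.cong[OF refl], clarify)
  fix a b x y assume t: "(a, b, x, y) \<in> quad M"
  then have "a * x > 0" "b * y > 0" "a * x + b * y = M" by (auto simp: quad_def)
  moreover from this have "sgn x = sgn a" "sgn y = sgn b" by (auto simp: zero_less_mult_iff)
  ultimately show "f a b x y = g a b x y" using assms by blast
qed

section \<open>Signed factorizations and the diagonal terms\<close>

definition hyp :: "int \<Rightarrow> (int \<times> int) set" where
  "hyp M = {(c, x). c * x = M}"

definition between_0 :: "int \<Rightarrow> int set" where
  "between_0 c = {0<..<c} \<union> {c<..<0}"

lemma finite_between_0 [simp]: "finite (between_0 c)" by (simp add: between_0_def)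

lemma finite_hyp [simp]:
  assumes "M > 0" shows "finite (hyp M)"
proof (rule finite_subset)
  show "hyp M \<subseteq> {-M..M} \<times> {-M..M}"
    using assms abs_le_mult_pos by (fastforce simp: hyp_def abs_le_iff)
qed auto

text \<open>On x = y the equation becomes (a + b) x = M. Positivity of a x and b x says that a and b
  have the sign of c = a + b, that is, b lies strictly between 0 and c.\<close>

lemma sum_quad_diag:
  assumes M: "M > 0"
  shows "(\<Sum>(a, b, x, y)\<in>quad M. if x = y then F a b x else 0) =
    (\<Sum>(c, x)\<in>hyp M. \<Sum>b\<in>between_0 c. F (c - b) b x)"
proof -
  have "(\<Sum>(a, b, x, y)\<in>quad M. if x = y then F a b x else 0)
      = (\<Sum>(a, b, x, y)\<in>{(a, b, x, y)\<in>quad M. x = y}. F a b x)"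
    by (rule sum.mono_neutral_cong_right) (auto split: if_splits)
  also have "\<dots> = (\<Sum>((c, x), b)\<in>Sigma (hyp M) (\<lambda>(c, x). between_0 c). F (c - b) b x)"
    by (rule sum.reindex_bij_witness[where i = "\<lambda>((c, x), b). (c - b, b, x, x)" and j = "\<lambda>(a, b, x, y). ((a + b, x), b)"])
      (use M in \<open>auto simp: quad_def hyp_def between_0_def zero_less_mult_iff algebra_simps\<close>)
  also have "\<dots> = (\<Sum>(c, x)\<in>hyp M. \<Sum>b\<in>between_0 c. F (c - b) b x)"
    using M by (subst sum.Sigma[symmetric]) (auto simp: case_prod_unfold)
  finally show ?thesis .
qed

section \<open>Counting and summing residue classes modulo 3 between 0 and c\<close>

lemma sum_between_0_uminus: "(\<Sum>b\<in>between_0 (- c). f b) = (\<Sum>b\<in>between_0 c. f (- b))"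
  by (rule sum.reindex_bij_witness[where i = uminus and j = uminus]) (auto simp: between_0_def)

lemma sum_between_0_Suc:
  "(\<Sum>b\<in>between_0 (int (Suc (Suc n))). f b) = f (int (Suc n)) + (\<Sum>b\<in>between_0 (int (Suc n)). f b)"
proof -
  have "between_0 (int (Suc (Suc n))) = insert (int (Suc n)) (between_0 (int (Suc n)))" by (auto simp: between_0_def)
  moreover have "int (Suc n) \<notin> between_0 (int (Suc n))" by (auto simp: between_0_def)
  ultimately show ?thesis by simp
qed

lemma between_0_1 [simp]: "between_0 1 = {}" by (auto simp: between_0_def)
lemma between_0_0 [simp]: "between_0 0 = {}" by (auto simp: between_0_def)

lemma count_between_0_nat:
  "(\<Sum>b\<in>between_0 (int (Suc n)). if b mod 3 = 0 then 1 else 0 :: int) = int n div 3"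
  "(\<Sum>b\<in>between_0 (int (Suc n)). if b mod 3 = 1 then 1 else 0 :: int) = (int n + 2) div 3"
  "(\<Sum>b\<in>between_0 (int (Suc n)). if b mod 3 = 2 then 1 else 0 :: int) = (int n + 1) div 3"
  by (induction n) (simp_all add: sum_between_0_Suc del: of_nat_Suc, (simp; presburger)+)

lemma sum_between_0_nat:
  "2 * (\<Sum>b\<in>between_0 (3 * int n). if b mod 3 = 2 then b else 0) = 3 * (int n)\<^sup>2 + int n"
  "2 * (\<Sum>b\<in>between_0 (3 * int n). if b mod 3 = 1 then b else 0) = 3 * (int n)\<^sup>2 - int n"
proof -
  have step: "(\<Sum>b\<in>between_0 (3 * int (Suc n)). f b) = (if n = 0 then 0 else f (3 * int n)) + f (3 * int n + 1) + f (3 * int n + 2) + (\<Sum>b\<in>between_0 (3 * int n). f b)"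
    for f :: "int \<Rightarrow> int" and n
  proof (cases n)
    case 0
    have "between_0 3 = {1, 2}" by (auto simp: between_0_def)
    with 0 show ?thesis by simp
  next
    case (Suc m)
    have "between_0 (3 * int (Suc n)) = insert (3 * int n) (insert (3 * int n + 1) (insert (3 * int n + 2) (between_0 (3 * int n))))"
      using Suc by (auto simp: between_0_def)
    moreover have "3 * int n \<notin> between_0 (3 * int n)" "3 * int n + 1 \<notin> between_0 (3 * int n)" "3 * int n + 2 \<notin> between_0 (3 * int n)"
      by (auto simp: between_0_def)
    ultimately show ?thesis using Suc by simp
  qed
  show "2 * (\<Sum>b\<in>between_0 (3 * int n). if b mod 3 = 2 then b else 0) = 3 * (int n)\<^sup>2 + int n"
  proof (induction n)
    case (Suc n)
    have "2 * (\<Sum>b\<in>between_0 (3 * int (Suc n)). if b mod 3 = 2 then b else 0) = 2 * (3 * int n + 2) + 2 * (\<Sum>b\<in>between_0 (3 * int n). if b mod 3 = 2 then b else 0)"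
      unfolding step by (simp add: mod_simps; presburger)
    then show ?case using Suc by (simp add: power2_eq_square algebra_simps)
  qed simp
  show "2 * (\<Sum>b\<in>between_0 (3 * int n). if b mod 3 = 1 then b else 0) = 3 * (int n)\<^sup>2 - int n"
  proof (induction n)
    case (Suc n)
    have "2 * (\<Sum>b\<in>between_0 (3 * int (Suc n)). if b mod 3 = 1 then b else 0) = 2 * (3 * int n + 1) + 2 * (\<Sum>b\<in>between_0 (3 * int n). if b mod 3 = 1 then b else 0)"
      unfolding step by (simp add: mod_simps; presburger)
    then show ?case using Suc by (simp add: power2_eq_square algebra_simps)
  qed simp
qed

lemma card_between_0: "c \<noteq> 0 \<Longrightarrow> (\<Sum>b\<in>between_0 c. 1) = \<bar>c\<bar> - 1"
  by (cases "c > 0") (auto simp: between_0_def not_less)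

lemma neg_mod_3:
  fixes b :: int
  shows "- b mod 3 = 0 \<longleftrightarrow> b mod 3 = 0" "- b mod 3 = 1 \<longleftrightarrow> b mod 3 = 2" "- b mod 3 = 2 \<longleftrightarrow> b mod 3 = 1"
  by presburger+

lemma int_nonzero_cases:
  fixes c :: int
  assumes "c \<noteq> 0"
  obtains n where "c = int (Suc n)" | n where "c = - int (Suc n)"
  using assms by (metis int_cases3 gr0_implies_Suc)

lemma count_between_0_1:
  assumes "c mod 3 = 2"
  shows "3 * (\<Sum>b\<in>between_0 c. if b mod 3 = 1 then 1 else 0) = sgn c * (c + 1)"
proof -
  have "c \<noteq> 0" using assms by auto
  then show ?thesis
  proof (cases rule: int_nonzero_cases)
    case (1 n)
    then show ?thesis using assms by (simp only: count_between_0_nat) (simp; presburger)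
  next
    case (2 n)
    then show ?thesis using assms by (simp only: sum_between_0_uminus neg_mod_3 count_between_0_nat) (simp; presburger)
  qed
qed

text \<open>The count is (|c| - 1) / 3 for c > 0 and (|c| - 2) / 3 for c < 0. The right-hand side
  covers both with one expression, so that sums over \<open>hyp\<close> need no case distinction on
  the sign.\<close>

lemma count_between_0_0:
  assumes "c mod 3 = 1"
  shows "6 * (\<Sum>b\<in>between_0 c. if b mod 3 = 0 then 1 else 0) = sgn c * (2 * c + 1) - 3"
proof -
  have "c \<noteq> 0" using assms by auto
  then show ?thesis
  proof (cases rule: int_nonzero_cases)
    case (1 n)
    then show ?thesis using assms by (simp only: count_between_0_nat) (simp; presburger)
  next
    case (2 n)
    then show ?thesis using assms by (simp only: sum_between_0_uminus neg_mod_3 count_between_0_nat) (simp; presburger)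
  qed
qed

lemma count_between_0_mult_3: "(\<Sum>b\<in>between_0 (3 * k). if b mod 3 = 2 then 1 else 0) = \<bar>k\<bar>"
proof (cases "k = 0")
  case False
  then have "3 * k \<noteq> 0" by simp
  then show ?thesis
  proof (cases rule: int_nonzero_cases)
    case (1 n)
    then show ?thesis by (simp only: count_between_0_nat; presburger)
  next
    case (2 n)
    then show ?thesis by (simp only: sum_between_0_uminus neg_mod_3 count_between_0_nat; presburger)
  qed
qed simp

lemma sum_between_0_mult_3: "2 * (\<Sum>b\<in>between_0 (3 * k). if b mod 3 = 2 then b else 0) = sgn k * (3 * k\<^sup>2 + k)"
proof (cases "k = 0")
  case False
  then show ?thesis
  proof (cases rule: int_nonzero_cases)
    case (1 n)
    then show ?thesis by (simp only: sum_between_0_nat) simp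
  next
    case (2 n)
    have "2 * (\<Sum>b\<in>between_0 (3 * k). if b mod 3 = 2 then b else 0) = 2 * (\<Sum>b\<in>between_0 (3 * int (Suc n)). if b mod 3 = 1 then - b else 0)"
      unfolding 2 by (simp only: mult_minus_right sum_between_0_uminus neg_mod_3)
    also have "\<dots> = - (2 * (\<Sum>b\<in>between_0 (3 * int (Suc n)). if b mod 3 = 1 then b else 0))"
      by (simp only: sum_negf[symmetric] mult_minus_right[symmetric] if_distrib[of uminus] minus_zero)
    also have "\<dots> = sgn k * (3 * k\<^sup>2 + k)"
    proof -
      have k: "k = - 1 - int n" using 2 by simp
      show ?thesis unfolding sum_between_0_nat k by (simp add: power2_eq_square algebra_simps)
    qed
    finally show ?thesis .
  qed
qed simp

text \<open>The conjugate of \<open>quad_split\<close> under exchanging (a, b) with (x, y), which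
  preserves the signs because sgn x = sgn a and sgn y = sgn b on \<open>quad M\<close>. In this form
  the first substitution fixes a, as needed for weights linear in a.\<close>

lemma quad_split_transposed:
  fixes g :: "int \<Rightarrow> int \<Rightarrow> int \<Rightarrow> int \<Rightarrow> int"
  assumes M: "M \<noteq> 0"
    and g: "\<And>a b x y. a = 0 \<or> b = 0 \<or> x = 0 \<or> y = 0 \<Longrightarrow> g a b x y = 0"
  shows "(\<Sum>(a, b, x, y)\<in>quad M. sgn a * sgn b * g a b x y) =
      (\<Sum>(a, b, x, y)\<in>quad M. if a = b then sgn a * sgn b * g a b x y else 0)
    + (\<Sum>(a, b, x, y)\<in>quad M. if x = - y then sgn a * sgn b * g a b x y else 0)
    + (\<Sum>(a, b, x, y)\<in>quad M. sgn a * sgn b * g a (a + b) (x - y) y)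
    + (\<Sum>(a, b, x, y)\<in>quad M. sgn a * sgn b * g (a + b) a y (x - y))"
proof -
  have tr: "(\<Sum>(a, b, x, y)\<in>quad M. if P a b x y then sgn a * sgn b * h a b x y else 0)
      = (\<Sum>(a, b, x, y)\<in>quad M. if P x y a b then sgn a * sgn b * h x y a b else 0)"
    for h :: "int \<Rightarrow> int \<Rightarrow> int \<Rightarrow> int \<Rightarrow> int" and P
    by (subst sum_quad_transpose) (rule sum_quad_cong, auto)
  note tr' = tr[where P = "\<lambda>_ _ _ _. True", simplified]
  have "(\<Sum>(a, b, x, y)\<in>quad M. sgn a * sgn b * g a b x y) = (\<Sum>(a, b, x, y)\<in>quad M. sgn a * sgn b * g x y a b)"
    by (rule tr')
  also have "\<dots> = (\<Sum>(a, b, x, y)\<in>quad M. if x = y then sgn a * sgn b * g x y a b else 0)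
    + (\<Sum>(a, b, x, y)\<in>quad M. if a = - b then sgn a * sgn b * g x y a b else 0)
    + (\<Sum>(a, b, x, y)\<in>quad M. sgn a * sgn b * g x (x + y) (a - b) b)
    + (\<Sum>(a, b, x, y)\<in>quad M. sgn a * sgn b * g (x + y) x b (a - b))"
    by (rule quad_split[OF M]) (use g in blast)
  also have "(\<Sum>(a, b, x, y)\<in>quad M. if x = y then sgn a * sgn b * g x y a b else 0)
      = (\<Sum>(a, b, x, y)\<in>quad M. if a = b then sgn a * sgn b * g a b x y else 0)"
    by (rule tr)
  also have "(\<Sum>(a, b, x, y)\<in>quad M. if a = - b then sgn a * sgn b * g x y a b else 0)
      = (\<Sum>(a, b, x, y)\<in>quad M. if x = - y then sgn a * sgn b * g a b x y else 0)"
    by (rule tr)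
  also have "(\<Sum>(a, b, x, y)\<in>quad M. sgn a * sgn b * g x (x + y) (a - b) b)
      = (\<Sum>(a, b, x, y)\<in>quad M. sgn a * sgn b * g a (a + b) (x - y) y)"
    by (rule tr')
  also have "(\<Sum>(a, b, x, y)\<in>quad M. sgn a * sgn b * g (x + y) x b (a - b))
      = (\<Sum>(a, b, x, y)\<in>quad M. sgn a * sgn b * g (a + b) a y (x - y))"
    by (rule tr')
  finally show ?thesis .
qed

lemma sum_hyp_transpose: "(\<Sum>(c, x)\<in>hyp M. f c x) = (\<Sum>(c, x)\<in>hyp M. f x c)"
  by (rule sum.reindex_bij_witness[where i = "\<lambda>(a, b). (b, a)" and j = "\<lambda>(a, b). (b, a)"])
    (auto simp: hyp_def mult.commute)

lemma sum_hyp_neg_transpose: "(\<Sum>(c, x)\<in>hyp M. f c x) = (\<Sum>(c, x)\<in>hyp M. f (- x) (- c))"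
  by (rule sum.reindex_bij_witness[where i = "\<lambda>(a, b). (- b, - a)" and j = "\<lambda>(a, b). (- b, - a)"])
    (auto simp: hyp_def mult.commute)

lemma sum_hyp_cong:
  assumes "M > 0" "\<And>c x. c * x = M \<Longrightarrow> c \<noteq> 0 \<Longrightarrow> x \<noteq> 0 \<Longrightarrow> sgn x = sgn c \<Longrightarrow> f c x = g c x"
  shows "(\<Sum>(c, x)\<in>hyp M. f c x) = (\<Sum>(c, x)\<in>hyp M. g c x)"
proof (rule sum.cong[OF refl], clarify)
  fix c x assume "(c, x) \<in> hyp M"
  then have "c * x = M" by (simp add: hyp_def)
  moreover from this have "c \<noteq> 0" "x \<noteq> 0" "sgn x = sgn c" using assms(1) by (auto simp: zero_less_mult_iff)
  ultimately show "f c x = g c x" using assms(2) by blast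
qed

lemma sum_hyp_mult_3:
  "(\<Sum>(c, x)\<in>hyp (3 * N). if c mod 3 = 0 then f c x else 0) = (\<Sum>(c, x)\<in>hyp N. f (3 * c) x)"
  if "N > 0"
proof -
  have "(\<Sum>(c, x)\<in>hyp (3 * N). if c mod 3 = 0 then f c x else 0)
      = (\<Sum>(c, x)\<in>{(c, x)\<in>hyp (3 * N). c mod 3 = 0}. f c x)"
    by (rule sum.mono_neutral_cong_right) (use that in \<open>auto split: if_splits\<close>)
  also have "\<dots> = (\<Sum>(c, x)\<in>hyp N. f (3 * c) x)"
    by (rule sum.reindex_bij_witness[where i = "\<lambda>(c, x). (3 * c, x)" and j = "\<lambda>(c, x). (c div 3, x)"])
      (auto simp: hyp_def)
  finally show ?thesis .
qed

lemma sum_quad_mult_3: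
  "(\<Sum>(a, b, x, y)\<in>quad (3 * N). if a mod 3 = 0 \<and> y mod 3 = 0 then f a b x y else 0)
     = (\<Sum>(a, b, x, y)\<in>quad N. f (3 * a) b x (3 * y))"
proof -
  have "(\<Sum>(a, b, x, y)\<in>quad (3 * N). if a mod 3 = 0 \<and> y mod 3 = 0 then f a b x y else 0)
      = (\<Sum>(a, b, x, y)\<in>{(a, b, x, y)\<in>quad (3 * N). a mod 3 = 0 \<and> y mod 3 = 0}. f a b x y)"
    by (rule sum.mono_neutral_cong_right) (auto split: if_splits)
  also have "\<dots> = (\<Sum>(a, b, x, y)\<in>quad N. f (3 * a) b x (3 * y))"
    by (rule sum.reindex_bij_witness[where i = "\<lambda>(a, b, x, y). (3 * a, b, x, 3 * y)" and j = "\<lambda>(a, b, x, y). (a div 3, b, x, y div 3)"])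
      (auto simp: quad_def zero_less_mult_iff elim!: dvdE)
  finally show ?thesis .
qed

section \<open>Evaluating the weighted sums over solutions\<close>

text \<open>The diagonal a = -b is empty because a and b are both 1 mod 3. Both generic terms
  acquire the residue pattern \<open>h\<close>, whose signed sum is 0. Only x = y remains, where
  counting b gives (|c| + sgn c) / 3, and the terms sgn c cancel under (c, x) to (-x, -c). As M = 2
  mod 3, each positive divisor d is |c| for exactly one admissible c, so the right-hand side is
  sigma(M).\<close>

lemma quad_weight_2:
  assumes M: "M > 0" "M mod 3 = 2"
  shows "3 * (\<Sum>(a, b, x, y)\<in>quad M. sgn a * sgn b * (if a mod 3 = 1 \<and> b mod 3 = 1 \<and> x mod 3 = 1 \<and> y mod 3 = 1 then 1 else 0))
    = (\<Sum>(c, x)\<in>hyp M. if c mod 3 = 2 \<and> x mod 3 = 1 then \<bar>c\<bar> else 0)"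
proof -
  define g :: "int \<Rightarrow> int \<Rightarrow> int \<Rightarrow> int \<Rightarrow> int" where
    "g = (\<lambda>a b x y. if a mod 3 = 1 \<and> b mod 3 = 1 \<and> x mod 3 = 1 \<and> y mod 3 = 1 then 1 else 0)"
  define h :: "int \<Rightarrow> int \<Rightarrow> int \<Rightarrow> int \<Rightarrow> int" where
    "h = (\<lambda>a b x y. if a mod 3 = 2 \<and> b mod 3 = 1 \<and> x mod 3 = 1 \<and> y mod 3 = 0 then 1 else 0)"
  \<comment> \<open>(a, x) to (-x, -a) preserves the equation and the residues but flips the sign.\<close>
  have "(\<Sum>(a, b, x, y)\<in>quad M. sgn a * sgn b * h a b x y) = (\<Sum>(a, b, x, y)\<in>quad M. - (sgn a * sgn b * h a b x y))"
    (is "?H = _")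
  proof -
    have "?H = (\<Sum>(a, b, x, y)\<in>quad M. sgn (- x) * sgn b * h (- x) b (- a) y)"
      by (rule sum.reindex_bij_witness[where i = "\<lambda>(a, b, x, y). (- x, b, - a, y)" and j = "\<lambda>(a, b, x, y). (- x, b, - a, y)"])
        (auto simp: quad_def mult.commute)
    also have "\<dots> = (\<Sum>(a, b, x, y)\<in>quad M. - (sgn a * sgn b * h a b x y))"
    proof (rule sum_quad_cong)
      fix a b x y :: int assume "sgn x = sgn a"
      moreover have "h (- x) b (- a) y = h a b x y" by (auto simp: h_def neg_mod_3)
      ultimately show "sgn (- x) * sgn b * h (- x) b (- a) y = - (sgn a * sgn b * h a b x y)"
        by simp
    qed
    finally show ?thesis .
  qed
  then have H: "?H = 0" by (simp add: case_prod_unfold sum_negf)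
  have "(\<Sum>(a, b, x, y)\<in>quad M. sgn a * sgn b * g a b x y)
    = (\<Sum>(a, b, x, y)\<in>quad M. if x = y then sgn a * sgn b * g a b x y else 0)
    + (\<Sum>(a, b, x, y)\<in>quad M. if a = - b then sgn a * sgn b * g a b x y else 0)
    + (\<Sum>(a, b, x, y)\<in>quad M. sgn a * sgn b * g (a - b) b x (x + y))
    + (\<Sum>(a, b, x, y)\<in>quad M. sgn a * sgn b * g b (a - b) (x + y) x)"
    by (rule quad_split) (use M in \<open>auto simp: g_def\<close>)
  also have "(\<Sum>(a, b, x, y)\<in>quad M. if a = - b then sgn a * sgn b * g a b x y else 0) = (\<Sum>(a, b, x, y)\<in>quad M. 0)"
    by (rule sum_quad_cong) (auto simp: g_def neg_mod_3)
  also have "(\<lambda>a b x y. g (a - b) b x (x + y)) = h"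
    unfolding g_def h_def by (intro ext if_cong refl) presburger
  then have "(\<Sum>(a, b, x, y)\<in>quad M. sgn a * sgn b * g (a - b) b x (x + y)) = ?H" by metis
  also have "(\<lambda>a b x y. g b (a - b) (x + y) x) = h"
    unfolding g_def h_def by (intro ext if_cong refl) presburger
  then have "(\<Sum>(a, b, x, y)\<in>quad M. sgn a * sgn b * g b (a - b) (x + y) x) = ?H" by metis
  also have "(\<Sum>(a, b, x, y)\<in>quad M. if x = y then sgn a * sgn b * g a b x y else 0)
     = (\<Sum>(a, b, x, y)\<in>quad M. if x = y then g a b x x else 0)"
    by (rule sum_quad_cong) (auto simp: zero_less_mult_iff)
  also have "\<dots> = (\<Sum>(c, x)\<in>hyp M. \<Sum>b\<in>between_0 c. g (c - b) b x x)"
    by (rule sum_quad_diag) fact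
  also have "\<dots> = (\<Sum>(c, x)\<in>hyp M. if c mod 3 = 2 \<and> x mod 3 = 1 then \<Sum>b\<in>between_0 c. if b mod 3 = 1 then 1 else 0 else 0)"
  proof (rule sum_hyp_cong)
    fix c x :: int
    have "g (c - b) b x x = (if c mod 3 = 2 \<and> x mod 3 = 1 then if b mod 3 = 1 then 1 else 0 else 0)" for b
    proof -
      have "(c - b) mod 3 = 1 \<and> b mod 3 = 1 \<longleftrightarrow> c mod 3 = 2 \<and> b mod 3 = 1" by presburger
      then show ?thesis unfolding g_def by auto
    qed
    then show "(\<Sum>b\<in>between_0 c. g (c - b) b x x) = (if c mod 3 = 2 \<and> x mod 3 = 1 then \<Sum>b\<in>between_0 c. if b mod 3 = 1 then 1 else 0 else 0)"
      by (cases "c mod 3 = 2 \<and> x mod 3 = 1") (simp_all only: simp_thms if_True if_False sum.neutral_const)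
  qed fact
  finally have "(\<Sum>(a, b, x, y)\<in>quad M. sgn a * sgn b * g a b x y)
      = (\<Sum>(c, x)\<in>hyp M. if c mod 3 = 2 \<and> x mod 3 = 1 then \<Sum>b\<in>between_0 c. if b mod 3 = 1 then 1 else 0 else 0)"
    unfolding H by simp
  then have "3 * (\<Sum>(a, b, x, y)\<in>quad M. sgn a * sgn b * g a b x y)
      = (\<Sum>(c, x)\<in>hyp M. 3 * (if c mod 3 = 2 \<and> x mod 3 = 1 then \<Sum>b\<in>between_0 c. if b mod 3 = 1 then 1 else 0 else 0))"
    by (simp add: sum_distrib_left case_prod_unfold)
  also have "\<dots> = (\<Sum>(c, x)\<in>hyp M. (if c mod 3 = 2 \<and> x mod 3 = 1 then \<bar>c\<bar> else 0) + (if c mod 3 = 2 \<and> x mod 3 = 1 then sgn c else 0))"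
    by (rule sum_hyp_cong) (use M count_between_0_1 in \<open>auto simp: distrib_left abs_sgn mult.commute\<close>)
  also have "\<dots> = (\<Sum>(c, x)\<in>hyp M. if c mod 3 = 2 \<and> x mod 3 = 1 then \<bar>c\<bar> else 0)
      + (\<Sum>(c, x)\<in>hyp M. if c mod 3 = 2 \<and> x mod 3 = 1 then sgn c else 0)" (is "_ = _ + ?Z")
    by (simp add: case_prod_unfold sum.distrib)
  also have "?Z = 0"
  proof -
    have "?Z = (\<Sum>(c, x)\<in>hyp M. if - x mod 3 = 2 \<and> - c mod 3 = 1 then sgn (- x) else 0)"
      by (rule sum_hyp_neg_transpose)
    also have "\<dots> = (\<Sum>(c, x)\<in>hyp M. - (if c mod 3 = 2 \<and> x mod 3 = 1 then sgn c else 0))"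
      by (rule sum_hyp_cong) (use M in \<open>auto simp: neg_mod_3\<close>)
    also have "\<dots> = - ?Z" by (simp add: case_prod_unfold sum_negf)
    finally show ?thesis by simp
  qed
  finally show ?thesis by (simp add: g_def)
qed

text \<open>The sum to which the surviving generic term of the triple evaluation reduces after its
  factor 3 is removed; a and b are no longer restricted modulo 3.\<close>

definition vsum :: "int \<Rightarrow> int" where
  "vsum N = (\<Sum>(a, b, x, y)\<in>quad N. sgn a * sgn b * (if x mod 3 = 1 \<and> y mod 3 = 1 then a else 0))"

text \<open>The split is applied to the weight \<open>w\<close> with y = 0 mod 3 rather than to that
  of \<open>vsum\<close>. The first substitution reproduces \<open>w\<close>; the second turns it
  into x = y = 1 mod 3 with weight a + b, which is twice \<open>vsum\<close> up to diagonals. Since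
  the two copies of \<open>W\<close> cancel, only divisor sums remain.\<close>

lemma vsum_eq:
  assumes N: "N > 0"
  shows "6 * vsum N = (\<Sum>(c, x)\<in>hyp N. if x mod 3 = 1 then sgn c * (3 * c\<^sup>2 - 2 * N - c) else 0)"
proof -
  define w :: "int \<Rightarrow> int \<Rightarrow> int \<Rightarrow> int" where
    "w = (\<lambda>a x y. if x mod 3 = 1 \<and> y mod 3 = 0 then a else 0)"
  define v :: "int \<Rightarrow> int \<Rightarrow> int \<Rightarrow> int" where
    "v = (\<lambda>a x y. if x mod 3 = 1 \<and> y mod 3 = 1 then a else 0)"
  \<comment> \<open>The split needs a weight vanishing at zero coordinates. \<open>w\<close> does so
    at a = 0 and x = 0 by itself and is cut off at b = 0 and y = 0. The cuts, moved by the
    substitutions to a = -b and x = y, produce the second copy of \<open>A\<close> and the term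
    \<open>X\<close>.\<close>
  define g :: "int \<Rightarrow> int \<Rightarrow> int \<Rightarrow> int \<Rightarrow> int" where
    "g = (\<lambda>a b x y. if b \<noteq> 0 \<and> y \<noteq> 0 then w a x y else 0)"
  define W where "W = (\<Sum>(a, b, x, y)\<in>quad N. sgn a * sgn b * w a x y)"
  define A where "A = (\<Sum>(a, b, x, y)\<in>quad N. if a = b then w a x y else 0)"
  define X where "X = (\<Sum>(a, b, x, y)\<in>quad N. if x = y then v (a + b) x x else 0)"
  have w_mod: "w a (x - y) y = w a x y" for a x y
  proof -
    have "(x - y) mod 3 = 1 \<and> y mod 3 = 0 \<longleftrightarrow> x mod 3 = 1 \<and> y mod 3 = 0" by presburger
    then show ?thesis by (simp add: w_def)
  qed
  have v_mod: "w a y (x - y) = v a x y" for a x y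
  proof -
    have "y mod 3 = 1 \<and> (x - y) mod 3 = 0 \<longleftrightarrow> x mod 3 = 1 \<and> y mod 3 = 1" by presburger
    then show ?thesis by (simp add: w_def v_def)
  qed
  \<comment> \<open>W occurs on both sides of the split and cancels, so the split evaluates the remaining terms.\<close>
  have "W = (\<Sum>(a, b, x, y)\<in>quad N. sgn a * sgn b * g a b x y)"
    unfolding W_def by (rule sum_quad_cong) (auto simp: g_def)
  also have "\<dots> = (\<Sum>(a, b, x, y)\<in>quad N. if a = b then sgn a * sgn b * g a b x y else 0)
    + (\<Sum>(a, b, x, y)\<in>quad N. if x = - y then sgn a * sgn b * g a b x y else 0)
    + (\<Sum>(a, b, x, y)\<in>quad N. sgn a * sgn b * g a (a + b) (x - y) y)
    + (\<Sum>(a, b, x, y)\<in>quad N. sgn a * sgn b * g (a + b) a y (x - y))"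
    by (rule quad_split_transposed) (use N in \<open>auto simp: g_def w_def\<close>)
  also have "(\<Sum>(a, b, x, y)\<in>quad N. if a = b then sgn a * sgn b * g a b x y else 0) = A"
    unfolding A_def by (rule sum_quad_cong) (auto simp: g_def zero_less_mult_iff)
  also have "(\<Sum>(a, b, x, y)\<in>quad N. if x = - y then sgn a * sgn b * g a b x y else 0) = (\<Sum>(a, b, x, y)\<in>quad N. 0)"
    by (rule sum_quad_cong) (auto simp: g_def w_def neg_mod_3)
  also have "(\<Sum>(a, b, x, y)\<in>quad N. sgn a * sgn b * g a (a + b) (x - y) y)
     = (\<Sum>(a, b, x, y)\<in>quad N. sgn a * sgn b * w a x y + (if a = - b then w a x y else 0))"
    by (rule sum_quad_cong) (auto simp: g_def w_mod zero_less_mult_iff add_eq_0_iff2)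
  also have "\<dots> = W + (\<Sum>(a, b, x, y)\<in>quad N. if a = - b then w a x y else 0)"
    by (simp add: W_def case_prod_unfold sum.distrib)
  also have "(\<Sum>(a, b, x, y)\<in>quad N. if a = - b then w a x y else 0)
      = (\<Sum>(a, b, x, y)\<in>quad N. if a = - (- b) then w a x (- y) else 0)"
    by (rule sum_quad_neg_snd)
  also have "\<dots> = A" unfolding A_def by (rule sum_quad_cong) (auto simp: w_def neg_mod_3)
  also have "(\<Sum>(a, b, x, y)\<in>quad N. sgn a * sgn b * g (a + b) a y (x - y))
     = (\<Sum>(a, b, x, y)\<in>quad N. sgn a * sgn b * v a x y + sgn a * sgn b * v b x y - (if x = y then v (a + b) x x else 0))"
    by (rule sum_quad_cong) (auto simp: g_def v_mod v_def zero_less_mult_iff distrib_left)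
  also have "\<dots> = vsum N + (\<Sum>(a, b, x, y)\<in>quad N. sgn a * sgn b * v b x y) - X"
    by (simp add: vsum_def v_def X_def case_prod_unfold sum.distrib sum_subtractf)
  also have "(\<Sum>(a, b, x, y)\<in>quad N. sgn a * sgn b * v b x y) = (\<Sum>(a, b, x, y)\<in>quad N. sgn b * sgn a * v a y x)"
    by (rule sum_quad_swap)
  also have "\<dots> = vsum N"
    unfolding vsum_def v_def by (rule sum_quad_cong) auto
  finally have eq: "2 * vsum N = X - 2 * A" by simp
  have "X = (\<Sum>(c, x)\<in>hyp N. \<Sum>b\<in>between_0 c. v (c - b + b) x x)"
    unfolding X_def by (rule sum_quad_diag) fact
  also have "\<dots> = (\<Sum>(c, x)\<in>hyp N. if x mod 3 = 1 then c * (\<bar>c\<bar> - 1) else 0)"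
    by (rule sum_hyp_cong) (use N card_between_0 in \<open>auto simp: v_def sum_distrib_left[symmetric] mult.commute\<close>)
  finally have X: "X = \<dots>" .
  have "A = (\<Sum>(a, b, x, y)\<in>quad N. if x = y then w x a b else 0)"
    unfolding A_def by (rule sum_quad_transpose)
  also have "\<dots> = (\<Sum>(c, x)\<in>hyp N. \<Sum>b\<in>between_0 c. w x (c - b) b)"
    by (rule sum_quad_diag) fact
  also have "\<dots> = (\<Sum>(c, x)\<in>hyp N. if c mod 3 = 1 then x * (\<Sum>b\<in>between_0 c. if b mod 3 = 0 then 1 else 0) else 0)"
    unfolding w_mod by (rule sum_hyp_cong) (use N in \<open>auto simp: sum_distrib_left w_def intro!: sum.cong\<close>)
  also have "\<dots> = (\<Sum>(c, x)\<in>hyp N. if x mod 3 = 1 then c * (\<Sum>b\<in>between_0 x. if b mod 3 = 0 then 1 else 0) else 0)"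
    by (rule sum_hyp_transpose)
  finally have A: "A = \<dots>" .
  have "6 * vsum N = 3 * X - 6 * A" using eq by simp
  also have "\<dots> = (\<Sum>(c, x)\<in>hyp N. 3 * (if x mod 3 = 1 then c * (\<bar>c\<bar> - 1) else 0)
       - 6 * (if x mod 3 = 1 then c * (\<Sum>b\<in>between_0 x. if b mod 3 = 0 then 1 else 0) else 0))"
    unfolding X A by (simp add: case_prod_unfold sum_subtractf sum_distrib_left)
  also have "\<dots> = (\<Sum>(c, x)\<in>hyp N. if x mod 3 = 1 then sgn c * (3 * c\<^sup>2 - 2 * N - c) else 0)"
  proof (rule sum_hyp_cong)
    fix c x assume cx: "c * x = N" "sgn x = sgn c"
    show "3 * (if x mod 3 = 1 then c * (\<bar>c\<bar> - 1) else 0) - 6 * (if x mod 3 = 1 then c * (\<Sum>b\<in>between_0 x. if b mod 3 = 0 then 1 else 0) else 0)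
      = (if x mod 3 = 1 then sgn c * (3 * c\<^sup>2 - 2 * N - c) else 0)"
    proof (cases "x mod 3 = 1")
      case True
      have "6 * (c * (\<Sum>b\<in>between_0 x. if b mod 3 = 0 then 1 else 0)) = c * (sgn c * (2 * x + 1) - 3)"
        using count_between_0_0[OF True] cx(2) by (metis mult.left_commute)
      moreover have "\<bar>c\<bar> = sgn c * c" by (simp add: abs_sgn mult.commute)
      ultimately show ?thesis using True
        by (simp add: cx(1)[symmetric] algebra_simps power2_eq_square)
    qed simp
  qed fact
  finally show ?thesis .
qed

text \<open>Both diagonals contribute here. The generic terms share the pattern \<open>u\<close>;
  after a sign flip of (b, y) the second has weight -(a + b), so the weight b cancels against the
  first and -\<open>U\<close> remains, which descends to 3 \<open>vsum N\<close>. Doubled, the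
  integrands on c x = N are sgn c times 3 c^2 + c, 2 N and 3 c^2 - 2 N - c, whose sum is 6
  c^2.\<close>

lemma quad_weight_3:
  assumes N: "N > 0"
  shows "(\<Sum>(a, b, x, y)\<in>quad (3 * N). sgn a * sgn b * (if a mod 3 = 1 \<and> b mod 3 = 2 \<and> x mod 3 = 1 \<and> y mod 3 = 1 then b else 0))
    = 3 * (\<Sum>(c, x)\<in>hyp N. if x mod 3 = 1 then sgn c * c\<^sup>2 else 0)"
proof -
  define g :: "int \<Rightarrow> int \<Rightarrow> int \<Rightarrow> int \<Rightarrow> int" where
    "g = (\<lambda>a b x y. if a mod 3 = 1 \<and> b mod 3 = 2 \<and> x mod 3 = 1 \<and> y mod 3 = 1 then b else 0)"
  have N3: "3 * N > 0" using N by simp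
  define u :: "int \<Rightarrow> int \<Rightarrow> int \<Rightarrow> int \<Rightarrow> int \<Rightarrow> int" where
    "u = (\<lambda>t a b x y. if a mod 3 = 0 \<and> y mod 3 = 0 then if b mod 3 = 2 \<and> x mod 3 = 1 then t else 0 else 0)"
  define K where "K = (\<Sum>(a, b, x, y)\<in>quad (3 * N). sgn a * sgn b * g a b x y)"
  define P1 where "P1 = (\<Sum>(a, b, x, y)\<in>quad (3 * N). if x = y then g a b x x else 0)"
  define P2 where "P2 = (\<Sum>(a, b, x, y)\<in>quad (3 * N). if x = y then if a mod 3 = 1 \<and> b mod 3 = 2 \<and> x mod 3 = 1 then x else 0 else 0)"
  define U where "U = (\<Sum>(a, b, x, y)\<in>quad (3 * N). sgn a * sgn b * u a a b x y)"
  have "K = (\<Sum>(a, b, x, y)\<in>quad (3 * N). if x = y then sgn a * sgn b * g a b x y else 0)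
    + (\<Sum>(a, b, x, y)\<in>quad (3 * N). if a = - b then sgn a * sgn b * g a b x y else 0)
    + (\<Sum>(a, b, x, y)\<in>quad (3 * N). sgn a * sgn b * g (a - b) b x (x + y))
    + (\<Sum>(a, b, x, y)\<in>quad (3 * N). sgn a * sgn b * g b (a - b) (x + y) x)"
    unfolding K_def by (rule quad_split) (use N in \<open>auto simp: g_def\<close>)
  also have "(\<Sum>(a, b, x, y)\<in>quad (3 * N). if x = y then sgn a * sgn b * g a b x y else 0) = P1"
    unfolding P1_def by (rule sum_quad_cong) (auto simp: zero_less_mult_iff)
  \<comment> \<open>The flip turns a = -b into a = b, and transposition turns that into x = y. The
    weight becomes x, so counting b yields x |c|, which is N sgn c after the descent.\<close>
  also have "(\<Sum>(a, b, x, y)\<in>quad (3 * N). if a = - b then sgn a * sgn b * g a b x y else 0)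
      = (\<Sum>(a, b, x, y)\<in>quad (3 * N). if a = - (- b) then sgn a * sgn (- b) * g a (- b) x (- y) else 0)"
    by (rule sum_quad_neg_snd)
  also have "\<dots> = (\<Sum>(a, b, x, y)\<in>quad (3 * N). if a = b then if x mod 3 = 1 \<and> y mod 3 = 2 \<and> a mod 3 = 1 then a else 0 else 0)"
    by (rule sum_quad_cong) (auto simp: zero_less_mult_iff g_def neg_mod_3)
  also have "\<dots> = P2" unfolding P2_def by (rule sum_quad_transpose)
  also have "(\<Sum>(a, b, x, y)\<in>quad (3 * N). sgn a * sgn b * g (a - b) b x (x + y))
      = (\<Sum>(a, b, x, y)\<in>quad (3 * N). sgn a * sgn b * u b a b x y)"
  proof (rule sum_quad_cong)
    fix a b x y :: int
    have "(a - b) mod 3 = 1 \<and> b mod 3 = 2 \<and> x mod 3 = 1 \<and> (x + y) mod 3 = 1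
      \<longleftrightarrow> (a mod 3 = 0 \<and> y mod 3 = 0) \<and> b mod 3 = 2 \<and> x mod 3 = 1" by presburger
    then show "sgn a * sgn b * g (a - b) b x (x + y) = sgn a * sgn b * u b a b x y" 
      by (auto simp: g_def u_def)
  qed
  also have "(\<Sum>(a, b, x, y)\<in>quad (3 * N). sgn a * sgn b * g b (a - b) (x + y) x)
     = (\<Sum>(a, b, x, y)\<in>quad (3 * N). sgn a * sgn (- b) * g (- b) (a - (- b)) (x + (- y)) x)"
    by (rule sum_quad_neg_snd)
  also have "\<dots> = (\<Sum>(a, b, x, y)\<in>quad (3 * N). - (sgn a * sgn b * u a a b x y) - sgn a * sgn b * u b a b x y)"
  proof (rule sum_quad_cong)
    fix a b x y :: int
    have "- b mod 3 = 1 \<and> (a - (- b)) mod 3 = 2 \<and> (x + (- y)) mod 3 = 1 \<and> x mod 3 = 1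
      \<longleftrightarrow> (a mod 3 = 0 \<and> y mod 3 = 0) \<and> b mod 3 = 2 \<and> x mod 3 = 1" by presburger
    then have "g (- b) (a - (- b)) (x + (- y)) x = u a a b x y + u b a b x y"
      unfolding g_def u_def by auto
    then show "sgn a * sgn (- b) * g (- b) (a - (- b)) (x + (- y)) x = - (sgn a * sgn b * u a a b x y) - sgn a * sgn b * u b a b x y"
      by (simp add: distrib_left)
  qed
  also have "\<dots> = - U - (\<Sum>(a, b, x, y)\<in>quad (3 * N). sgn a * sgn b * u b a b x y)"
    by (simp add: U_def case_prod_unfold sum_subtractf sum_negf)
  finally have K: "K = P1 + P2 - U" by simp
  have "P1 = (\<Sum>(c, x)\<in>hyp (3 * N). \<Sum>b\<in>between_0 c. g (c - b) b x x)"
    unfolding P1_def by (rule sum_quad_diag) fact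
  also have "\<dots> = (\<Sum>(c, x)\<in>hyp (3 * N). if c mod 3 = 0 then if x mod 3 = 1 then \<Sum>b\<in>between_0 c. if b mod 3 = 2 then b else 0 else 0 else 0)"
  proof (rule sum_hyp_cong)
    fix c x :: int
    have "g (c - b) b x x = (if c mod 3 = 0 then if x mod 3 = 1 then if b mod 3 = 2 then b else 0 else 0 else 0)" for b
    proof -
      have "(c - b) mod 3 = 1 \<and> b mod 3 = 2 \<longleftrightarrow> c mod 3 = 0 \<and> b mod 3 = 2" by presburger
      then show ?thesis unfolding g_def by auto
    qed
    then show "(\<Sum>b\<in>between_0 c. g (c - b) b x x) = (if c mod 3 = 0 then if x mod 3 = 1 then \<Sum>b\<in>between_0 c. if b mod 3 = 2 then b else 0 else 0 else 0)"
      by simp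
  qed fact
  also have "\<dots> = (\<Sum>(c, x)\<in>hyp N. if x mod 3 = 1 then \<Sum>b\<in>between_0 (3 * c). if b mod 3 = 2 then b else 0 else 0)"
    by (rule sum_hyp_mult_3) fact
  finally have P1: "P1 = \<dots>" .
  have "P2 = (\<Sum>(c, x)\<in>hyp (3 * N). \<Sum>b\<in>between_0 c. if (c - b) mod 3 = 1 \<and> b mod 3 = 2 \<and> x mod 3 = 1 then x else 0)"
    unfolding P2_def by (rule sum_quad_diag) fact
  also have "\<dots> = (\<Sum>(c, x)\<in>hyp (3 * N). if c mod 3 = 0 then if x mod 3 = 1 then x * (\<Sum>b\<in>between_0 c. if b mod 3 = 2 then 1 else 0) else 0 else 0)"
  proof (rule sum_hyp_cong)
    fix c x :: int
    have "(if (c - b) mod 3 = 1 \<and> b mod 3 = 2 \<and> x mod 3 = 1 then x else 0)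
       = (if c mod 3 = 0 then if x mod 3 = 1 then x * (if b mod 3 = 2 then 1 else 0) else 0 else 0)" for b
    proof -
      have "(c - b) mod 3 = 1 \<and> b mod 3 = 2 \<longleftrightarrow> c mod 3 = 0 \<and> b mod 3 = 2" by presburger
      then show ?thesis by auto
    qed
    then show "(\<Sum>b\<in>between_0 c. if (c - b) mod 3 = 1 \<and> b mod 3 = 2 \<and> x mod 3 = 1 then x else 0)
      = (if c mod 3 = 0 then if x mod 3 = 1 then x * (\<Sum>b\<in>between_0 c. if b mod 3 = 2 then 1 else 0) else 0 else 0)"
      by (simp only: sum_distrib_left) simp
  qed fact
  also have "\<dots> = (\<Sum>(c, x)\<in>hyp N. if x mod 3 = 1 then x * (\<Sum>b\<in>between_0 (3 * c). if b mod 3 = 2 then 1 else 0) else 0)"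
    by (rule sum_hyp_mult_3) fact
  also have "\<dots> = (\<Sum>(c, x)\<in>hyp N. if x mod 3 = 1 then N * sgn c else 0)"
  proof (rule sum_hyp_cong)
    fix c x assume "c * x = N"
    then have "x * \<bar>c\<bar> = N * sgn c" by (simp add: abs_sgn mult.commute mult.left_commute)
    then show "(if x mod 3 = 1 then x * (\<Sum>b\<in>between_0 (3 * c). if b mod 3 = 2 then 1 else 0) else 0)
      = (if x mod 3 = 1 then N * sgn c else 0)"
      by (simp only: count_between_0_mult_3)
  qed fact
  finally have P2: "P2 = \<dots>" .
  \<comment> \<open>In the pattern \<open>u\<close> both products contain a factor 3, so the
    equation itself descends to N. Exchanging b with y and negating both changes the condition b = 2
    mod 3 into y = 1 mod 3, at the cost of a sign.\<close>
  have "U = (\<Sum>(a, b, x, y)\<in>quad (3 * N). if a mod 3 = 0 \<and> y mod 3 = 0 then sgn a * sgn b * (if b mod 3 = 2 \<and> x mod 3 = 1 then a else 0) else 0)"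
    unfolding U_def by (rule sum_quad_cong) (auto simp: u_def)
  also have "\<dots> = (\<Sum>(a, b, x, y)\<in>quad N. sgn (3 * a) * sgn b * (if b mod 3 = 2 \<and> x mod 3 = 1 then 3 * a else 0))"
    by (rule sum_quad_mult_3)
  also have "\<dots> = (\<Sum>(a, b, x, y)\<in>quad N. sgn (3 * a) * sgn y * (if y mod 3 = 2 \<and> x mod 3 = 1 then 3 * a else 0))"
    by (rule sum_quad_transpose_snd)
  also have "\<dots> = (\<Sum>(a, b, x, y)\<in>quad N. sgn (3 * a) * sgn (- y) * (if - y mod 3 = 2 \<and> x mod 3 = 1 then 3 * a else 0))"
    by (rule sum_quad_neg_snd)
  also have "\<dots> = (\<Sum>(a, b, x, y)\<in>quad N. (- 3) * (sgn a * sgn b * (if x mod 3 = 1 \<and> y mod 3 = 1 then a else 0)))"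
    by (rule sum_quad_cong) (auto simp: neg_mod_3 sgn_mult)
  also have "\<dots> = - 3 * vsum N"
    unfolding vsum_def by (simp add: sum_distrib_left case_prod_unfold)
  finally have U: "U = - 3 * vsum N" .
  have "2 * K = 2 * P1 + 2 * P2 + 6 * vsum N" using K U by simp
  also have "\<dots> = (\<Sum>(c, x)\<in>hyp N. 2 * (if x mod 3 = 1 then \<Sum>b\<in>between_0 (3 * c). if b mod 3 = 2 then b else 0 else 0)
      + 2 * (if x mod 3 = 1 then N * sgn c else 0) + (if x mod 3 = 1 then sgn c * (3 * c\<^sup>2 - 2 * N - c) else 0))"
    unfolding P1 P2 vsum_eq[OF N] by (simp add: case_prod_unfold sum.distrib sum_distrib_left)
  also have "\<dots> = (\<Sum>(c, x)\<in>hyp N. 6 * (if x mod 3 = 1 then sgn c * c\<^sup>2 else 0))"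
    by (rule sum_hyp_cong) (use N sum_between_0_mult_3 in \<open>auto simp: algebra_simps\<close>)
  also have "\<dots> = 6 * (\<Sum>(c, x)\<in>hyp N. if x mod 3 = 1 then sgn c * c\<^sup>2 else 0)"
    by (simp add: case_prod_unfold sum_distrib_left)
  finally show ?thesis by (simp add: K_def g_def)
qed

section \<open>Eisenstein integers of given norm\<close>

definition chi :: "nat \<Rightarrow> int" where
  "chi n = (if n mod 3 = 1 then 1 else if n mod 3 = 2 then -1 else 0)"

lemma chi_mult: "chi (m * n) = chi m * chi n"
proof -
  have "m mod 3 = 0 \<or> m mod 3 = 1 \<or> m mod 3 = 2" "n mod 3 = 0 \<or> n mod 3 = 1 \<or> n mod 3 = 2" by presburger+
  then show ?thesis unfolding chi_def by (elim disjE) (simp_all add: mod_mult_eq[of m 3 n, symmetric])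
qed

definition divisor_sum :: "(nat \<Rightarrow> int) \<Rightarrow> (nat \<Rightarrow> int) \<Rightarrow> nat \<Rightarrow> int" where
  "divisor_sum f g n = (\<Sum>d | d dvd n. f d * g (n div d))"

lemma divisor_sum_1 [simp]: "divisor_sum f g (Suc 0) = f 1 * g 1"
  by (simp add: divisor_sum_def)

lemma divisors_prime_mult:
  fixes p n :: nat
  assumes "prime p" "n > 0"
  shows "{d. d dvd p * n} = {d. d dvd n} \<union> (*) p ` {d. d dvd n}"
proof (intro equalityI subsetI)
  fix d assume "d \<in> {d. d dvd p * n}"
  then have d: "d dvd p * n" by simp
  show "d \<in> {d. d dvd n} \<union> (*) p ` {d. d dvd n}"
  proof (cases "p dvd d")
    case True
    then obtain e where "d = p * e" by (elim dvdE)
    with d assms show ?thesis by auto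
  next
    case False
    then have "coprime d p" using assms(1) by (metis coprime_commute prime_imp_coprime)
    with d show ?thesis by (simp add: coprime_dvd_mult_right_iff)
  qed
qed auto

text \<open>The Hecke-type recursion of a Dirichlet convolution of completely multiplicative
  functions, by inclusion-exclusion: divisors of p n are those of n together with p times those of
  n, and the overlap is p times the divisors of n / p.\<close>

lemma divisor_sum_prime_mult:
  fixes f g :: "nat \<Rightarrow> int"
  assumes f: "\<And>m n. f (m * n) = f m * f n" and g: "\<And>m n. g (m * n) = g m * g n"
    and p: "prime p" and n: "n > 0"
  shows "divisor_sum f g (p * n) = (f p + g p) * divisor_sum f g n
    - (if p dvd n then f p * g p * divisor_sum f g (n div p) else 0)"
proof -
  have p0: "p > 0" using p prime_gt_0_nat by blast
  have inj: "inj_on ((*) p) A" for A using p0 by (auto simp: inj_on_def)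
  have fin: "finite {d. d dvd n}" using n by simp
  let ?h = "\<lambda>d. f d * g (p * n div d)"
  have "divisor_sum f g (p * n) = sum ?h {d. d dvd n} + sum ?h ((*) p ` {d. d dvd n})
      - sum ?h ({d. d dvd n} \<inter> (*) p ` {d. d dvd n})"
    unfolding divisor_sum_def divisors_prime_mult[OF p n]
    by (rule sum_Un) (use fin in auto)
  also have "sum ?h {d. d dvd n} = g p * divisor_sum f g n"
    unfolding divisor_sum_def sum_distrib_left
    by (rule sum.cong) (auto simp: div_mult_swap[symmetric] g)
  also have "sum ?h ((*) p ` {d. d dvd n}) = f p * divisor_sum f g n"
    unfolding divisor_sum_def sum_distrib_left
    by (subst sum.reindex[OF inj]) (use p0 in \<open>auto simp: f mult.assoc intro!: sum.cong\<close>)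
  also have "sum ?h ({d. d dvd n} \<inter> (*) p ` {d. d dvd n}) = (if p dvd n then f p * g p * divisor_sum f g (n div p) else 0)"
  proof (cases "p dvd n")
    case True
    then obtain m where m: "n = p * m" by (elim dvdE)
    have "{d. d dvd n} \<inter> (*) p ` {d. d dvd n} = (*) p ` {d. d dvd m}"
      using p0 m by auto
    then have "sum ?h ({d. d dvd n} \<inter> (*) p ` {d. d dvd n}) = (\<Sum>d | d dvd m. ?h (p * d))"
      by (simp add: sum.reindex[OF inj] o_def)
    also have "\<dots> = f p * g p * divisor_sum f g m"
      unfolding divisor_sum_def sum_distrib_left
      by (rule sum.cong) (use p0 in \<open>auto simp: f g m div_mult_swap[symmetric]\<close>)
    finally show ?thesis using True p0 m by simp
  next
    case False
    then have "{d. d dvd n} \<inter> (*) p ` {d. d dvd n} = {}" by auto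
    with False show ?thesis by simp
  qed
  finally show ?thesis by (simp add: algebra_simps)
qed

section \<open>The norm form and its behaviour at each prime\<close>

definition norm_reps :: "nat \<Rightarrow> (int \<times> int) set" where
  "norm_reps n = {(x, y). x\<^sup>2 - x * y + y\<^sup>2 = int n}"

lemma four_norm: "4 * (x\<^sup>2 - x * y + y\<^sup>2) = (2 * x - y)\<^sup>2 + 3 * y\<^sup>2" for x y :: int
  by (simp add: power2_eq_square algebra_simps)

lemma norm_reps_bounds:
  assumes "(x, y) \<in> norm_reps n"
  shows "3 * x\<^sup>2 \<le> 4 * int n" "3 * y\<^sup>2 \<le> 4 * int n"
proof -
  have "x\<^sup>2 - x * y + y\<^sup>2 = int n" using assms by (simp add: norm_reps_def)
  then have "4 * int n = (2 * x - y)\<^sup>2 + 3 * y\<^sup>2" "4 * int n = (2 * y - x)\<^sup>2 + 3 * x\<^sup>2"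
    using four_norm[of x y] four_norm[of y x] by (simp_all add: mult.commute)
  then show "3 * x\<^sup>2 \<le> 4 * int n" "3 * y\<^sup>2 \<le> 4 * int n"
    using zero_le_power2[of "2 * x - y"] zero_le_power2[of "2 * y - x"] by linarith+
qed

lemma finite_norm_reps [simp]: "finite (norm_reps n)"
proof (rule finite_subset)
  have "\<bar>x\<bar> \<le> 2 * int n" if "3 * x\<^sup>2 \<le> 4 * int n" for x
  proof -
    have "\<bar>x\<bar> \<le> x\<^sup>2" 
    proof (cases "x = 0")
      case False
      then have "\<bar>x\<bar> * 1 \<le> \<bar>x\<bar> * \<bar>x\<bar>" by (intro mult_left_mono) auto
      then show ?thesis by (simp add: power2_eq_square)
    qed simp
    with that show ?thesis by linarith
  qed
  with norm_reps_bounds show "norm_reps n \<subseteq> {-2 * int n..2 * int n} \<times> {-2 * int n..2 * int n}"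
    by (fastforce simp: abs_le_iff)
qed auto

lemma card_norm_reps_1: "card (norm_reps (Suc 0)) = 6"
proof -
  have "norm_reps (Suc 0) = {(1, 0), (-1, 0), (0, 1), (0, -1), (1, 1), (-1, -1)}" (is "_ = ?S")
  proof
    show "norm_reps (Suc 0) \<subseteq> ?S"
    proof (rule subrelI)
      fix x y assume xy: "(x, y) \<in> norm_reps (Suc 0)"
      have "z \<in> {-1, 0, 1}" if "3 * z\<^sup>2 \<le> 4" for z :: int
      proof -
        have "\<bar>z\<bar>\<^sup>2 < 2\<^sup>2" using that by simp
        then have "\<bar>z\<bar> < 2" by (rule power2_less_imp_less) simp
        then show ?thesis by auto
      qed
      then have "x \<in> {-1, 0, 1}" "y \<in> {-1, 0, 1}" using norm_reps_bounds[OF xy] by auto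
      then show "(x, y) \<in> ?S" using xy by (auto simp: norm_reps_def)
    qed
  qed (auto simp: norm_reps_def)
  then show ?thesis by simp
qed

text \<open>Here (x, y) stands for the Eisenstein integer x + y w with w^2 + w + 1 = 0, and p divides y u - x v
  precisely when the prime u + v w above p divides x + y w.\<close>

lemma card_norm_reps_prime_dvd:
  fixes u v :: int
  assumes p: "prime p" and uv: "u\<^sup>2 - u * v + v\<^sup>2 = int p"
  shows "card {(x, y) \<in> norm_reps (p * n). int p dvd y * u - x * v} = card (norm_reps n)"
proof -
  have p0: "int p > 0" using p prime_gt_0_nat by simp
  \<comment> \<open>The map is multiplication by u + v w; its inverse multiplies by the conjugate u
    - v - v w and divides by p.\<close>
  have "bij_betw (\<lambda>(x, y). (u * x - v * y, u * y + v * x - v * y)) (norm_reps n)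
      {(x, y) \<in> norm_reps (p * n). int p dvd y * u - x * v}"
  proof (rule bij_betw_byWitness[where f' = "\<lambda>(x, y). ((x * u - x * v + y * v) div int p, (y * u - x * v) div int p)"])
    show "\<forall>t\<in>norm_reps n. (case case t of (x, y) \<Rightarrow> (u * x - v * y, u * y + v * x - v * y) of
        (x, y) \<Rightarrow> ((x * u - x * v + y * v) div int p, (y * u - x * v) div int p)) = t"
    proof
      fix t :: "int \<times> int"
      obtain x y where t: "t = (x, y)" by fastforce
      have "(u * x - v * y) * u - (u * x - v * y) * v + (u * y + v * x - v * y) * v = int p * x"
        "(u * y + v * x - v * y) * u - (u * x - v * y) * v = int p * y"
        unfolding uv[symmetric] by (simp_all add: power2_eq_square algebra_simps)
      then show "(case case t of (x, y) \<Rightarrow> (u * x - v * y, u * y + v * x - v * y) of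
        (x, y) \<Rightarrow> ((x * u - x * v + y * v) div int p, (y * u - x * v) div int p)) = t"
        using p0 by (simp add: t)
    qed
    have sub: "\<exists>X Y. x * u - x * v + y * v = int p * X \<and> y * u - x * v = int p * Y
        \<and> u * X - v * Y = x \<and> u * Y + v * X - v * Y = y \<and> (X, Y) \<in> norm_reps n"
      if xy: "(x, y) \<in> norm_reps (p * n)" and d: "int p dvd y * u - x * v" for x y
    proof -
      obtain Y where Y: "y * u - x * v = int p * Y" using d by (elim dvdE)
      have N: "x\<^sup>2 - x * y + y\<^sup>2 = int p * int n" using xy by (simp add: norm_reps_def)
      \<comment> \<open>Only the w-coordinate of the product with the conjugate is assumed divisible
        by p. The product has norm p^2 n, which forces p to divide Z^2, hence also the other
        coordinate.\<close>
      define Z where "Z = x * u - x * v + y * v"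
      have nZ: "Z\<^sup>2 - Z * (y * u - x * v) + (y * u - x * v)\<^sup>2 = int p * int p * int n"
      proof -
        have "Z\<^sup>2 - Z * (y * u - x * v) + (y * u - x * v)\<^sup>2 = (u\<^sup>2 - u * v + v\<^sup>2) * (x\<^sup>2 - x * y + y\<^sup>2)"
          unfolding Z_def by (simp add: power2_eq_square algebra_simps)
        then show ?thesis unfolding uv N by simp
      qed
      then have "Z\<^sup>2 = int p * (int p * int n + Z * Y - int p * Y\<^sup>2)"
        unfolding Y by (simp add: power2_eq_square algebra_simps)
      then have "int p dvd Z\<^sup>2" by simp
      then have "int p dvd Z" using p by (simp add: prime_dvd_power_iff)
      then obtain X where X: "Z = int p * X" by (elim dvdE)
      have "int p * (u * X - v * Y) = u * Z - v * (y * u - x * v)" unfolding X Y by (simp add: algebra_simps)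
      also have "\<dots> = (u\<^sup>2 - u * v + v\<^sup>2) * x" unfolding Z_def by (simp add: power2_eq_square algebra_simps)
      finally have 1: "u * X - v * Y = x" unfolding uv using p0 by simp
      have "int p * (u * Y + v * X - v * Y) = (u - v) * (y * u - x * v) + v * Z" unfolding X Y by (simp add: algebra_simps)
      also have "\<dots> = (u\<^sup>2 - u * v + v\<^sup>2) * y" unfolding Z_def by (simp add: power2_eq_square algebra_simps)
      finally have 2: "u * Y + v * X - v * Y = y" unfolding uv using p0 by simp
      have "(int p * int p) * (X\<^sup>2 - X * Y + Y\<^sup>2) = (int p * int p) * int n"
        using nZ unfolding X Y by (simp add: power2_eq_square algebra_simps)
      then have "X\<^sup>2 - X * Y + Y\<^sup>2 = int n" using p0 by simp
      then show ?thesis using X Y 1 2 unfolding Z_def by (auto simp: norm_reps_def)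
    qed
    show "\<forall>t\<in>{(x, y) \<in> norm_reps (p * n). int p dvd y * u - x * v}.
       (case case t of (x, y) \<Rightarrow> ((x * u - x * v + y * v) div int p, (y * u - x * v) div int p) of
        (x, y) \<Rightarrow> (u * x - v * y, u * y + v * x - v * y)) = t"
    proof
      fix t assume "t \<in> {(x, y) \<in> norm_reps (p * n). int p dvd y * u - x * v}"
      then obtain x y where t: "t = (x, y)" and "(x, y) \<in> norm_reps (p * n)" "int p dvd y * u - x * v" by blast
      from sub[OF this(2,3)] show "(case case t of (x, y) \<Rightarrow> ((x * u - x * v + y * v) div int p, (y * u - x * v) div int p) of
        (x, y) \<Rightarrow> (u * x - v * y, u * y + v * x - v * y)) = t"
        using p0 by (auto simp: t)
    qed
    show "(\<lambda>(x, y). ((x * u - x * v + y * v) div int p, (y * u - x * v) div int p)) `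
        {(x, y) \<in> norm_reps (p * n). int p dvd y * u - x * v} \<subseteq> norm_reps n"
    proof clarify
      fix x y X Y assume "(x, y) \<in> norm_reps (p * n)" "int p dvd y * u - x * v"
      from sub[OF this] show "((x * u - x * v + y * v) div int p, (y * u - x * v) div int p) \<in> norm_reps n"
        using p0 by auto
    qed
    show "(\<lambda>(x, y). (u * x - v * y, u * y + v * x - v * y)) ` norm_reps n
        \<subseteq> {(x, y) \<in> norm_reps (p * n). int p dvd y * u - x * v}"
    proof clarify
      fix x y assume xy: "(x, y) \<in> norm_reps n"
      have "(u * y + v * x - v * y) * u - (u * x - v * y) * v = (u\<^sup>2 - u * v + v\<^sup>2) * y"
        by (simp add: power2_eq_square algebra_simps)
      then have "int p dvd (u * y + v * x - v * y) * u - (u * x - v * y) * v"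
        unfolding uv by simp
      moreover have "(u * x - v * y)\<^sup>2 - (u * x - v * y) * (u * y + v * x - v * y) + (u * y + v * x - v * y)\<^sup>2
         = (u\<^sup>2 - u * v + v\<^sup>2) * (x\<^sup>2 - x * y + y\<^sup>2)"
        by (simp add: power2_eq_square algebra_simps)
      ultimately show "(u * x - v * y, u * y + v * x - v * y) \<in> norm_reps (p * n) \<and> int p dvd (u * y + v * x - v * y) * u - (u * x - v * y) * v"
        using xy unfolding norm_reps_def uv by simp
    qed
  qed
  then show ?thesis by (simp add: bij_betw_same_card)
qed

lemma norm_reps_scale:
  assumes "p > 0"
  shows "(x * int p, y * int p) \<in> norm_reps (p * n) \<longleftrightarrow> p dvd n \<and> (x, y) \<in> norm_reps (n div p)"
proof
  assume "(x * int p, y * int p) \<in> norm_reps (p * n)"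
  then have "int p * (int p * (x\<^sup>2 - x * y + y\<^sup>2)) = int p * int n"
    by (simp add: norm_reps_def power2_eq_square algebra_simps)
  then have *: "int p * (x\<^sup>2 - x * y + y\<^sup>2) = int n" using assms by simp
  then have "p dvd n" by (metis dvd_triv_left int_dvd_int_iff)
  moreover from this have "int n = int p * int (n div p)" by (metis dvd_mult_div_cancel of_nat_mult)
  ultimately show "p dvd n \<and> (x, y) \<in> norm_reps (n div p)" using * assms by (simp add: norm_reps_def)
next
  assume *: "p dvd n \<and> (x, y) \<in> norm_reps (n div p)"
  then have "int n = int p * int (n div p)" by (metis dvd_mult_div_cancel of_nat_mult)
  moreover have "(x * int p)\<^sup>2 - x * int p * (y * int p) + (y * int p)\<^sup>2 = int p * (int p * (x\<^sup>2 - x * y + y\<^sup>2))"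
    by (simp add: power2_eq_square algebra_simps)
  ultimately show "(x * int p, y * int p) \<in> norm_reps (p * n)"
    using * by (simp add: norm_reps_def)
qed

lemma card_norm_reps_both_dvd:
  assumes "p > 0"
  shows "card {(x, y) \<in> norm_reps (p * n). int p dvd x \<and> int p dvd y} = (if p dvd n then card (norm_reps (n div p)) else 0)"
proof -
  have "{(x, y) \<in> norm_reps (p * n). int p dvd x \<and> int p dvd y}
     = (\<lambda>(x, y). (x * int p, y * int p)) ` (if p dvd n then norm_reps (n div p) else {})" (is "?L = ?R")
  proof
    show "?L \<subseteq> ?R"
    proof clarify
      fix x y assume xy: "(x, y) \<in> norm_reps (p * n)" "int p dvd x" "int p dvd y"
      obtain X Y where "x = X * int p" "y = Y * int p" using xy(2,3) by (metis dvd_div_mult_self)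
      with xy(1) norm_reps_scale[OF assms] show "(x, y) \<in> ?R" by (intro image_eqI[of _ _ "(X, Y)"]) auto
    qed
    show "?R \<subseteq> ?L" using norm_reps_scale[OF assms] by (auto split: if_splits)
  qed
  moreover have "inj_on (\<lambda>(x, y). (x * int p, y * int p)) A" for A
    using assms by (auto simp: inj_on_def)
  ultimately show ?thesis by (simp add: card_image)
qed

text \<open>The ramified prime: 3 is the norm of 1 - w, and x^2 - x y + y^2 = (x + y)^2 mod 3 shows
  that 1 - w divides every element whose norm is divisible by 3.\<close>

lemma card_norm_reps_mult_3: "card (norm_reps (3 * n)) = card (norm_reps n)"
proof -
  have "card {(x, y) \<in> norm_reps (3 * n). int 3 dvd y * 1 - x * (-1)} = card (norm_reps n)"
    by (rule card_norm_reps_prime_dvd) auto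
  moreover have "int 3 dvd y * 1 - x * (-1)" if "(x, y) \<in> norm_reps (3 * n)" for x y
  proof -
    have "x\<^sup>2 - x * y + y\<^sup>2 = 3 * int n" using that by (simp add: norm_reps_def)
    then have "(x + y)\<^sup>2 = 3 * (int n + x * y)" by (simp add: power2_eq_square algebra_simps)
    then have "3 dvd (x + y)\<^sup>2" by simp
    then have "3 dvd x + y" by (simp add: prime_dvd_power_iff)
    then show ?thesis by (simp add: add.commute)
  qed
  then have "{(x, y) \<in> norm_reps (3 * n). int 3 dvd y * 1 - x * (-1)} = norm_reps (3 * n)" by blast
  ultimately show ?thesis by simp
qed

lemma prime_3_nat: "prime (3 :: nat)"
  by simp

text \<open>Cubing is injective on nonzero residues because p - 1 = 1 mod 3. The form divides x^3 +
  y^3, so x^3 = (-y)^3 and hence x = -y mod p; the form is then 3 y^2 mod p, which contradicts p not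
  dividing y.\<close>

lemma inert_prime_dvd:
  fixes x y :: int
  assumes p: "prime p" "p mod 3 = 2" and d: "int p dvd x\<^sup>2 - x * y + y\<^sup>2"
  shows "int p dvd x \<and> int p dvd y"
proof -
  have pp: "prime (int p)" using p(1) by simp
  have *: "int p dvd y" if d: "int p dvd x\<^sup>2 - x * y + y\<^sup>2" for x y
  proof (rule ccontr)
    assume ny: "\<not> int p dvd y"
    have nx: "\<not> int p dvd x"
    proof
      assume "int p dvd x"
      then have "int p dvd x\<^sup>2 - x * y" by (simp add: power2_eq_square)
      with d have "int p dvd y\<^sup>2" by (simp add: dvd_add_right_iff)
      with ny pp show False by (simp add: prime_dvd_power_iff)
    qed
    define k where "k = p div 3"
    have k: "p - 1 = 3 * k + 1" using p(2) unfolding k_def by presburger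
    have pos: "0 \<le> z mod int p" for z using p(1) prime_gt_0_nat by simp
    have fermat: "[z ^ (p - 1) = 1] (mod int p)" if "\<not> int p dvd z" for z
    proof -
      have "\<not> p dvd nat (z mod int p)"
      proof
        assume "p dvd nat (z mod int p)"
        then have "int p dvd z mod int p" using pos by (simp add: int_dvd_int_iff[symmetric])
        with that show False by (simp add: dvd_mod_iff)
      qed
      then have "[nat (z mod int p) ^ (p - 1) = 1] (mod p)" using fermat_theorem p(1) by blast
      then have "[int (nat (z mod int p)) ^ (p - 1) = 1] (mod int p)"
        by (metis cong_int_iff of_nat_1 of_nat_power)
      moreover have "int (nat (z mod int p)) = z mod int p" using pos by simp
      ultimately show ?thesis by (simp add: cong_def power_mod)
    qed
    have "int p dvd (x\<^sup>2 - x * y + y\<^sup>2) * (x + y)" using d by simp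
    also have "(x\<^sup>2 - x * y + y\<^sup>2) * (x + y) = x ^ 3 - (- y) ^ 3"
      by (simp add: power2_eq_square power3_eq_cube algebra_simps)
    finally have "[x ^ 3 = (- y) ^ 3] (mod int p)" by (simp add: cong_iff_dvd_diff)
    then have c: "[x ^ (3 * k) = (- y) ^ (3 * k)] (mod int p)" by (simp add: power_mult cong_pow)
    have "[x * x ^ (3 * k) = - y * (- y) ^ (3 * k)] (mod int p)"
      using fermat[OF nx] fermat[of "- y"] ny unfolding k by (simp add: cong_def)
    moreover have "[- y * x ^ (3 * k) = - y * (- y) ^ (3 * k)] (mod int p)"
      using c by (rule cong_scalar_left)
    ultimately have "[x * x ^ (3 * k) = - y * x ^ (3 * k)] (mod int p)"
      by (simp only: cong_def)
    moreover have "coprime (x ^ (3 * k)) (int p)"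
    proof -
      have "coprime x (int p)" using nx pp by (metis coprime_commute prime_imp_coprime)
      then show ?thesis by simp
    qed
    ultimately have "[x = - y] (mod int p)" using cong_mult_rcancel by blast
    then have "int p dvd x + y" by (simp add: cong_iff_dvd_diff)
    moreover have "x\<^sup>2 - x * y + y\<^sup>2 = (x + y) * (x - 2 * y) + 3 * y\<^sup>2"
      by (simp add: power2_eq_square algebra_simps)
    ultimately have "int p dvd 3 * y\<^sup>2" using d by (metis dvd_add_right_iff dvd_mult2)
    then have "int p dvd 3" using ny pp by (simp add: prime_dvd_mult_iff prime_dvd_power_iff)
    then have "p dvd 3" by (metis int_dvd_int_iff of_nat_numeral)
    then have "p = 3" using primes_dvd_imp_eq[OF p(1) prime_3_nat] by simp
    with p(2) show False by simp
  qed
  have "y\<^sup>2 - y * x + x\<^sup>2 = x\<^sup>2 - x * y + y\<^sup>2" by simp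
  then show ?thesis using *[of x y] *[of y x] d by metis
qed

lemma card_norm_reps_inert:
  assumes p: "prime p" "p mod 3 = 2"
  shows "card (norm_reps (p * n)) = (if p dvd n then card (norm_reps (n div p)) else 0)"
proof -
  have "{(x, y) \<in> norm_reps (p * n). int p dvd x \<and> int p dvd y} = norm_reps (p * n)"
  proof -
    have "int p dvd x \<and> int p dvd y" if "(x, y) \<in> norm_reps (p * n)" for x y
      using that by (intro inert_prime_dvd[OF p]) (simp add: norm_reps_def)
    then show ?thesis by blast
  qed
  then show ?thesis using card_norm_reps_both_dvd[of p n] prime_gt_0_nat[OF p(1)] by simp
qed

text \<open>Pigeonhole: the box with sides from 0 to the integer part of the square root of p has
  more than p points, so two of them agree in x - t y mod p, and their difference works. The bounds
  are strict because p is not a square.\<close>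

lemma thue:
  fixes p :: nat and t :: int
  assumes p: "prime p"
  obtains x y :: int where "int p dvd x - t * y" "(x, y) \<noteq> (0, 0)" "x\<^sup>2 < int p" "y\<^sup>2 < int p"
proof -
  define s where "s = floor_sqrt p"
  have p0: "int p > 0" using p prime_gt_0_nat by simp
  have s1: "s\<^sup>2 < p"
  proof -
    have "s\<^sup>2 \<le> p" unfolding s_def by simp
    moreover have "s\<^sup>2 \<noteq> p" using p by (auto simp: prime_power_iff)
    ultimately show ?thesis by simp
  qed
  have s2: "p < (Suc s)\<^sup>2" unfolding s_def by (rule Suc_floor_sqrt_power2_gt)
  define A where "A = {0..int s} \<times> {0..int s}"
  define f where "f = (\<lambda>(x, y). (x - t * y) mod int p)"
  have "f ` A \<subseteq> {0..<int p}" using p0 by (auto simp: f_def)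
  then have "card (f ` A) \<le> p" using card_mono[of "{0..<int p}"] by simp
  also have "p < card A"
  proof -
    have "card {0..int s} = Suc s" by simp
    then show ?thesis using s2 by (simp only: A_def card_cartesian_product power2_eq_square)
  qed
  finally have "\<not> inj_on f A" by (rule pigeonhole)
  then obtain x1 y1 x2 y2 where A: "(x1, y1) \<in> A" "(x2, y2) \<in> A" "(x1, y1) \<noteq> (x2, y2)" "f (x1, y1) = f (x2, y2)"
    unfolding inj_on_def by auto
  have sq: "z\<^sup>2 < int p" if "\<bar>z\<bar> \<le> int s" for z
  proof -
    have "z\<^sup>2 \<le> (int s)\<^sup>2" using that by (simp add: abs_le_square_iff[symmetric])
    also have "\<dots> < int p" using s1 by (metis of_nat_less_iff of_nat_power)
    finally show ?thesis .
  qed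
  show ?thesis
  proof (rule that[of "x1 - x2" "y1 - y2"])
    have "int p dvd (x1 - t * y1) - (x2 - t * y2)" using A(4) by (simp add: f_def mod_eq_dvd_iff)
    then show "int p dvd (x1 - x2) - t * (y1 - y2)" by (simp add: algebra_simps)
    show "(x1 - x2, y1 - y2) \<noteq> (0, 0)" using A(3) by simp
    show "(x1 - x2)\<^sup>2 < int p" "(y1 - y2)\<^sup>2 < int p" using A(1,2) by (auto simp: A_def intro!: sq)
  qed
qed

lemma norm_pos:
  fixes x y :: int
  assumes "(x, y) \<noteq> (0, 0)"
  shows "x\<^sup>2 - x * y + y\<^sup>2 > 0"
proof -
  have "(2 * x - y)\<^sup>2 + 3 * y\<^sup>2 > 0"
  proof (cases "y = 0")
    case True
    with assms show ?thesis by simp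
  next
    case False
    then have "0 < y\<^sup>2" by simp
    then show ?thesis using zero_le_power2[of "2 * x - y"] by linarith
  qed
  then have "0 < 4 * (x\<^sup>2 - x * y + y\<^sup>2)" unfolding four_norm .
  then show ?thesis by simp
qed

text \<open>A primitive root raised to (p - 1) / 3 has order 3, hence is a zero of s^2 + s + 1.
  Passing to -s matches the sign of the mixed term in the norm form.\<close>

lemma sixth_root_mod_prime:
  assumes p: "prime p" "p mod 3 = 1"
  obtains t :: int where "int p dvd t\<^sup>2 - t + 1"
proof -
  obtain g where g: "residue_primroot p g" using prime_primitive_root_exists[of p] p(1) prime_gt_1_nat by blast
  define k where "k = p div 3"
  have k: "p - 1 = 3 * k" using p(2) unfolding k_def by presburger
  have p1: "p > 1" using p(1) prime_gt_1_nat by blast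
  with k have k0: "k > 0" by (cases k) auto
  have ord: "ord p g = 3 * k" using g p(1) k by (simp add: residue_primroot_def totient_prime)
  define s where "s = int g ^ k"
  have n1: "\<not> int p dvd s - 1"
  proof
    assume "int p dvd s - 1"
    then have "[int (g ^ k) = int 1] (mod int p)" by (simp add: cong_iff_dvd_diff s_def)
    then have "[g ^ k = 1] (mod p)" using cong_int_iff by blast
    then have "3 * k dvd k" unfolding ord_divides ord .
    with k0 show False by (auto dest: dvd_imp_le)
  qed
  have "[g ^ (3 * k) = 1] (mod p)" unfolding ord_divides ord by simp
  then have "[int (g ^ (3 * k)) = int 1] (mod int p)" using cong_int_iff by blast
  then have "int p dvd s ^ 3 - 1" by (simp add: cong_iff_dvd_diff s_def power_mult[symmetric] mult.commute)
  also have "s ^ 3 - 1 = (s - 1) * (s\<^sup>2 + s + 1)" by (simp add: power2_eq_square power3_eq_cube algebra_simps)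
  finally have "int p dvd s\<^sup>2 + s + 1" using n1 p(1) by (simp add: prime_dvd_mult_iff)
  then show ?thesis using that[of "- s"] by simp
qed

text \<open>A short vector with x = t y mod p has norm N divisible by p, and 2 N <= 3 (x^2 + y^2) <
  6 p leaves N = p or N = 2 p. The latter is impossible: 2 is inert, so N would be divisible by 4
  and p would be 2.\<close>

lemma split_prime_norm_reps:
  assumes p: "prime p" "p mod 3 = 1"
  obtains u v :: int where "u\<^sup>2 - u * v + v\<^sup>2 = int p"
proof -
  have p0: "int p > 0" using p(1) prime_gt_0_nat by simp
  obtain t where t: "int p dvd t\<^sup>2 - t + 1" using sixth_root_mod_prime[OF p] .
  obtain x y where xy: "int p dvd x - t * y" "(x, y) \<noteq> (0, 0)" "x\<^sup>2 < int p" "y\<^sup>2 < int p"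
    using thue[OF p(1)] .
  define N where "N = x\<^sup>2 - x * y + y\<^sup>2"
  have "N = (x - t * y) * (x + t * y - y) + y\<^sup>2 * (t\<^sup>2 - t + 1)"
    by (simp add: N_def power2_eq_square algebra_simps)
  also have "int p dvd \<dots>" using xy(1) t by simp
  finally obtain m where m: "N = int p * m" by (elim dvdE)
  have "int p * m > 0" using norm_pos[OF xy(2)] m by (simp add: N_def)
  then have m0: "m > 0" using p0 by (simp add: zero_less_mult_iff)
  have "2 * N \<le> 2 * N + (x + y)\<^sup>2" by simp
  also have "\<dots> = 3 * (x\<^sup>2 + y\<^sup>2)" by (simp add: N_def power2_eq_square algebra_simps)
  also have "\<dots> < 6 * int p" using xy(3,4) by simp
  finally have "2 * N < 6 * int p" .
  then have "int p * m < int p * 3" using m by linarith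
  then have "m < 3" using p0 by (simp only: mult_less_cancel_left_pos)
  then have "m = 1 \<or> m = 2" using m0 by auto
  then show ?thesis
  proof
    assume "m = 1"
    with m show ?thesis using that[of x y] by (simp add: N_def)
  next
    assume m2: "m = 2"
    then have "int 2 dvd N" using m by simp
    then have "int 2 dvd x \<and> int 2 dvd y" unfolding N_def by (intro inert_prime_dvd) auto
    then obtain a b where "x = 2 * a" "y = 2 * b" by (auto elim!: dvdE)
    then have "int p * 2 = 2 * (2 * (a\<^sup>2 - a * b + b\<^sup>2))" using m m2 by (simp add: N_def power2_eq_square algebra_simps)
    then have "int p = 2 * (a\<^sup>2 - a * b + b\<^sup>2)" by simp
    then have "even (int p)" by (metis dvd_triv_left)
    then have "even p" by simp
    then have "p = 2" using p(1) primes_dvd_imp_eq two_is_prime_nat by blast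
    with p(2) show ?thesis by simp
  qed
qed

text \<open>Here p is the product of u + v w and its conjugate (u - v) - v w. An element of norm p n
  is divisible by one of the two, and by both exactly when it is divisible by p, so
  inclusion-exclusion applies to \<open>A\<close> and \<open>B\<close>.\<close>

lemma card_norm_reps_split:
  assumes p: "prime p" "p mod 3 = 1"
  shows "int (card (norm_reps (p * n))) = 2 * int (card (norm_reps n)) - (if p dvd n then int (card (norm_reps (n div p))) else 0)"
proof -
  have pp: "prime (int p)" and p0: "p > 0" using p(1) prime_gt_0_nat by auto
  obtain u v where uv: "u\<^sup>2 - u * v + v\<^sup>2 = int p" using split_prime_norm_reps[OF p] .
  have uv': "(u - v)\<^sup>2 - (u - v) * (- v) + (- v)\<^sup>2 = int p"
    using uv by (simp add: power2_eq_square algebra_simps)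
  define A where "A = {(x, y) \<in> norm_reps (p * n). int p dvd y * u - x * v}"
  define B where "B = {(x, y) \<in> norm_reps (p * n). int p dvd y * (u - v) - x * (- v)}"
  have "card A = card (norm_reps n)" "card B = card (norm_reps n)"
    unfolding A_def B_def by (rule card_norm_reps_prime_dvd[OF p(1)], fact)+
  moreover have fin: "finite A" "finite B"
    by (rule finite_subset[OF _ finite_norm_reps[of "p * n"]], auto simp: A_def B_def)+
  moreover have "norm_reps (p * n) = A \<union> B"
  proof -
    have "int p dvd y * u - x * v \<or> int p dvd y * (u - v) - x * (- v)" if "(x, y) \<in> norm_reps (p * n)" for x y
    proof -
      have N: "x\<^sup>2 - x * y + y\<^sup>2 = int p * int n" using that by (simp add: norm_reps_def)
      have "(y * u - x * v) * (y * (u - v) - x * (- v)) = y\<^sup>2 * (u\<^sup>2 - u * v + v\<^sup>2) - v\<^sup>2 * (x\<^sup>2 - x * y + y\<^sup>2)"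
        by (simp add: power2_eq_square algebra_simps)
      also have "int p dvd \<dots>" unfolding uv N by simp
      finally show ?thesis using pp by (simp add: prime_dvd_mult_iff)
    qed
    then show ?thesis by (auto simp: A_def B_def)
  qed
  moreover have "A \<inter> B = {(x, y) \<in> norm_reps (p * n). int p dvd x \<and> int p dvd y}"
  proof -
    \<comment> \<open>This and the next fact express that the two primes above p are not associated:
      the two linear forms add up to y (2 u - v), whose second factor is prime to p because (2 u -
      v)^2 + 3 v^2 = 4 p.\<close>
    have nv: "\<not> int p dvd v"
    proof
      assume v: "int p dvd v"
      then have "int p dvd u\<^sup>2" using uv by (metis (no_types, lifting) dvd_add_left_iff dvd_diff_left_iff dvd_mult dvd_refl power2_eq_square dvd_mult2)
      then have "int p dvd u" using pp by (simp add: prime_dvd_power_iff)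
      with v obtain a b where "u = int p * a" "v = int p * b" by (metis dvd_def)
      then have "int p * (int p * (a\<^sup>2 - a * b + b\<^sup>2)) = int p * 1"
        using uv by (simp add: power2_eq_square algebra_simps)
      then have "int p dvd 1" using p0 by (metis dvd_triv_left mult_cancel_left of_nat_0_eq_iff neq0_conv)
      with pp show False using not_prime_unit by blast
    qed
    have nuv: "\<not> int p dvd 2 * u - v"
    proof
      assume "int p dvd 2 * u - v"
      then have "int p dvd (2 * u - v)\<^sup>2" by (simp add: power2_eq_square)
      moreover have "3 * v\<^sup>2 = 4 * int p - (2 * u - v)\<^sup>2"
        unfolding uv[symmetric] by (simp add: power2_eq_square algebra_simps)
      ultimately have "int p dvd 3 * v\<^sup>2" by simp
      then have "int p dvd 3" using nv pp by (simp add: prime_dvd_mult_iff prime_dvd_power_iff)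
      then have "p dvd 3" by (metis int_dvd_int_iff of_nat_numeral)
      then have "p = 3" using primes_dvd_imp_eq[OF p(1) prime_3_nat] by simp
      with p(2) show False by simp
    qed
    have "int p dvd x \<and> int p dvd y" if "int p dvd y * u - x * v" "int p dvd y * (u - v) - x * (- v)" for x y
    proof -
      have "int p dvd (y * u - x * v) + (y * (u - v) - x * (- v))" using that by (rule dvd_add)
      also have "\<dots> = y * (2 * u - v)" by (simp add: algebra_simps)
      finally have y: "int p dvd y" using nuv pp by (simp add: prime_dvd_mult_iff)
      then have "int p dvd x * v" using that(1) by (metis dvd_diff_right_iff dvd_mult2)
      then show ?thesis using nv pp y by (simp add: prime_dvd_mult_iff)
    qed
    moreover have "int p dvd y * u - x * v \<and> int p dvd y * (u - v) - x * (- v)" if "int p dvd x" "int p dvd y" for x y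
      using that by (intro conjI dvd_diff dvd_mult2)
    ultimately show ?thesis unfolding A_def B_def by blast
  qed
  ultimately have "card (norm_reps (p * n)) + (if p dvd n then card (norm_reps (n div p)) else 0) = 2 * card (norm_reps n)"
    using card_Un_Int[OF fin] card_norm_reps_both_dvd[OF p0, of n] by simp
  then show ?thesis by (auto split: if_splits)
qed

text \<open>The coefficients \<open>chi p + 1\<close> and \<open>chi p\<close> of the divisor
  recursion are 2 and 1 at split primes, 0 and -1 at inert primes, 1 and 0 at 3, in agreement with
  the three counts above. The factor 6 is the number of units, supplied by n = 1.\<close>

lemma card_norm_reps:
  "n > 0 \<Longrightarrow> int (card (norm_reps n)) = 6 * divisor_sum chi (\<lambda>_. 1) n"
proof (induction n rule: less_induct)
  case (less n)
  show ?case
  proof (cases "n = 1")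
    case True
    then show ?thesis by (simp add: card_norm_reps_1 chi_def)
  next
    case False
    then obtain p where p: "prime p" "p dvd n" using prime_factor_nat by blast
    then obtain m where m: "n = p * m" by (elim dvdE)
    have p1: "p > 1" using p(1) prime_gt_1_nat by blast
    have m0: "m > 0" "m < n" using less.prems m p1 by auto
    have IHm: "int (card (norm_reps m)) = 6 * divisor_sum chi (\<lambda>_. 1) m" using less.IH m0 by blast
    have IHk: "int (card (norm_reps (m div p))) = 6 * divisor_sum chi (\<lambda>_. 1) (m div p)" if "p dvd m"
    proof (rule less.IH)
      show "m div p < n" "m div p > 0" using m0 p1 that by (auto simp: div_greater_zero_iff dvd_imp_le intro: le_less_trans[OF div_le_dividend])
    qed
    have rec: "divisor_sum chi (\<lambda>_. 1) n = (chi p + 1) * divisor_sum chi (\<lambda>_. 1) m - (if p dvd m then chi p * divisor_sum chi (\<lambda>_. 1) (m div p) else 0)"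
      unfolding m by (subst divisor_sum_prime_mult) (auto simp: chi_mult p m0)
    have "p = 3" if "p mod 3 = 0"
      using primes_dvd_imp_eq[OF prime_3_nat p(1)] that by (simp add: dvd_eq_mod_eq_0)
    moreover have "p mod 3 = 0 \<or> p mod 3 = 1 \<or> p mod 3 = 2" by presburger
    ultimately consider "p mod 3 = 1" | "p mod 3 = 2" | "p = 3" by metis
    then show ?thesis
    proof cases
      case 1
      then have "chi p = 1" by (simp add: chi_def)
      then show ?thesis using card_norm_reps_split[OF p(1) 1, of m] IHm IHk unfolding rec by (simp add: m)
    next
      case 2
      then have "chi p = -1" by (simp add: chi_def)
      then show ?thesis using card_norm_reps_inert[OF p(1) 2, of m] IHm IHk unfolding rec by (simp add: m)
    next
      case 3
      then have "chi p = 0" by (simp add: chi_def)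
      then show ?thesis using card_norm_reps_mult_3[of m] IHm 3 unfolding rec by (simp add: m)
    qed
  qed
qed

section \<open>3-cores as pairs of natural numbers\<close>

text \<open>The first-column hook lengths: a row of length x with l rows below it contributes x +
  l.\<close>

fun beta_set :: "nat list \<Rightarrow> nat set" where
  "beta_set [] = {}"
| "beta_set (x # xs) = insert (x + length xs) (beta_set xs)"

lemma beta_set_conv_nth: "beta_set xs = (\<lambda>i. xs ! i + (length xs - 1 - i)) ` {..<length xs}"
proof (induction xs)
  case (Cons x xs)
  show ?case by (simp add: Cons lessThan_Suc_eq_insert_0 image_image)
qed simp

lemma finite_beta_set [simp]: "finite (beta_set xs)"
  by (induction xs) auto

lemma is_partition_Cons:
  "is_partition (x # xs) \<longleftrightarrow> 0 < x \<and> (\<forall>y\<in>set xs. y \<le> x) \<and> is_partition xs"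
  by (auto simp: is_partition_def)

lemma beta_set_less:
  assumes "\<And>y. y \<in> set xs \<Longrightarrow> y \<le> x" "b \<in> beta_set xs"
  shows "b < x + length xs"
  using assms by (induction xs) force+

lemma card_beta_set: "is_partition xs \<Longrightarrow> card (beta_set xs) = length xs"
proof (induction xs)
  case (Cons x xs)
  then have "x + length xs \<notin> beta_set xs" using beta_set_less[of xs x "x + length xs"] by (auto simp: is_partition_Cons)
  with Cons show ?case by (simp add: is_partition_Cons)
qed simp

text \<open>With L rows, the legs add 0 + 1 + ... + (L - 1) to the size. Doubling and moving L to
  the left avoids natural subtraction.\<close>

lemma sum_beta_set: "is_partition xs \<Longrightarrow> 2 * \<Sum>(beta_set xs) + length xs = 2 * psize xs + length xs * length xs"
proof (induction xs)
  case (Cons x xs)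
  then have "x + length xs \<notin> beta_set xs" using beta_set_less[of xs x "x + length xs"] by (auto simp: is_partition_Cons)
  with Cons show ?case by (simp add: is_partition_Cons psize_def)
qed (simp add: psize_def)

lemma zero_notin_beta_set: "is_partition xs \<Longrightarrow> 0 \<notin> beta_set xs"
  by (induction xs) (auto simp: is_partition_Cons)

lemma beta_set_inject:
  assumes "is_partition xs" "is_partition ys" "beta_set xs = beta_set ys"
  shows "xs = ys"
  using assms
proof (induction xs arbitrary: ys)
  case Nil
  then show ?case by (cases ys) auto
next
  case (Cons x xs)
  have len: "length (x # xs) = length ys" using Cons.prems card_beta_set by metis
  then obtain y zs where ys: "ys = y # zs" by (cases ys) auto
  have x: "\<And>b. b \<in> beta_set xs \<Longrightarrow> b < x + length xs" and y: "\<And>b. b \<in> beta_set zs \<Longrightarrow> b < y + length zs"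
    using beta_set_less Cons.prems unfolding ys is_partition_Cons by blast+
  have "insert (x + length xs) (beta_set xs) = insert (y + length zs) (beta_set zs)" using Cons.prems(3) ys by simp
  then have eq: "x + length xs = y + length zs" using x y
    by (metis insert_iff less_asym')
  moreover have "x + length xs \<notin> beta_set xs" "y + length zs \<notin> beta_set zs" using x y by blast+
  ultimately have "beta_set xs = beta_set zs" using Cons.prems(3) ys by (simp add: insert_ident)
  then have "xs = zs" using Cons by (simp add: ys is_partition_Cons)
  with eq show ?case by (simp add: ys)
qed

lemma beta_set_surj:
  assumes "finite X" "0 \<notin> X"
  shows "\<exists>xs. is_partition xs \<and> beta_set xs = X"
  using assms
proof (induction X rule: finite_linorder_max_induct)
  case empty
  show ?case by (rule exI[of _ "[]"]) (simp add: is_partition_def)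
next
  case (insert m X)
  then obtain xs where xs: "is_partition xs" "beta_set xs = X" by auto
  have *: "length xs < m \<and> (\<forall>y\<in>set xs. y \<le> m - length xs)"
  proof (cases xs)
    case Nil
    with insert.prems show ?thesis by auto
  next
    case (Cons y ys)
    then have "y + length ys < m" using insert.hyps xs by auto
    with xs(1) show ?thesis by (fastforce simp: Cons is_partition_Cons)
  qed
  then have "is_partition ((m - length xs) # xs)" using xs(1) by (simp add: is_partition_Cons)
  moreover have "beta_set ((m - length xs) # xs) = insert m X" using * xs(2) by simp
  ultimately show ?case by blast
qed

section \<open>Hooks as differences between beta numbers and gaps\<close>

lemma less_conj_part_iff:
  "is_partition xs \<Longrightarrow> i < conj_part xs j \<longleftrightarrow> i < length xs \<and> j < xs ! i"
proof (induction xs arbitrary: i)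
  case (Cons x xs)
  show ?case
  proof (cases "j < x")
    case True
    then show ?thesis using Cons by (cases i) (auto simp: conj_part_def is_partition_Cons)
  next
    case False
    have "\<not> j < (x # xs) ! i" if "i < length (x # xs)"
      using False Cons.prems nth_mem[OF that] by (auto simp: is_partition_Cons)
    moreover have "filter (\<lambda>r. j < r) (x # xs) = []"
      using False Cons.prems by (fastforce simp: is_partition_Cons filter_empty_conv)
    ultimately show ?thesis by (auto simp: conj_part_def)
  qed
qed (simp add: conj_part_def)

lemma conj_part_le: "conj_part xs j \<le> length xs"
  by (simp add: conj_part_def)

text \<open>The numbers missing from the beta-set are exactly j + length xs - conj_part xs j.\<close>

lemma gap_notin_beta_set:
  assumes "is_partition xs"
  shows "j + (length xs - conj_part xs j) \<notin> beta_set xs"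
proof
  assume "j + (length xs - conj_part xs j) \<in> beta_set xs"
  then obtain i where i: "i < length xs" "j + (length xs - conj_part xs j) = xs ! i + (length xs - 1 - i)"
    by (auto simp: beta_set_conv_nth)
  show False
  proof (cases "j < xs ! i")
    case True
    then have "i < conj_part xs j" using i less_conj_part_iff[OF assms] by simp
    with i True conj_part_le[of xs j] show False by linarith
  next
    case False
    then have "\<not> i < conj_part xs j" using less_conj_part_iff[OF assms] by simp
    with i False show False by linarith
  qed
qed

text \<open>Identifies a hook with the pair formed by the beta number of its row and the gap of its
  column. This turns divisibility of hook lengths into a condition on the beta-set alone.\<close>

lemma hook_length_eq:
  assumes "is_partition xs" "i < length xs" "j < xs ! i"
  shows "hook_length xs i j + (j + (length xs - conj_part xs j)) = xs ! i + (length xs - 1 - i)"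
proof -
  have "i < conj_part xs j" using less_conj_part_iff assms by simp
  with assms conj_part_le[of xs j] show ?thesis unfolding hook_length_def by linarith
qed

text \<open>Let r be the number of beta numbers above y. A column of height r has the gap j + L - r,
  which suggests j = y + r - L; all rows before r are longer than this j and row r, if present, is
  not, so the height is indeed r.\<close>

lemma gap_exists:
  assumes p: "is_partition xs" and i: "i < length xs"
    and y: "y \<notin> beta_set xs" "y < xs ! i + (length xs - 1 - i)"
  obtains j where "j < xs ! i" "y = j + (length xs - conj_part xs j)"
proof -
  define L where "L = length xs"
  define P where "P r \<longleftrightarrow> L \<le> r \<or> xs ! r + (L - 1 - r) < y" for r
  define r where "r = (LEAST r. P r)"
  have "P L" by (simp add: P_def)
  then have r: "P r" "r \<le> L" "\<And>k. k < r \<Longrightarrow> \<not> P k"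
    unfolding r_def by (auto intro: LeastI Least_le dest: not_less_Least)
  have mono: "xs ! b \<le> xs ! a" if "a \<le> b" "b < L" for a b
    using p that unfolding is_partition_def L_def
    by (metis le_neq_implies_less order_refl sorted_wrt_nth_less)
  have pos: "0 < xs ! a" if "a < L" for a
    using p that unfolding is_partition_def L_def by simp
  have Ly: "L \<le> y + r"
  proof (cases "r < L")
    case True
    then have "xs ! r + (L - 1 - r) < y" using r(1) by (simp add: P_def)
    with pos[OF True] True show ?thesis by linarith
  qed simp
  define j where "j = y + r - L"
  have big: "j < xs ! k" if "k < r" for k
  proof -
    have "\<not> P (r - 1)" using that r(3) by simp
    then have r1: "r - 1 < L" "y \<le> xs ! (r - 1) + (L - 1 - (r - 1))" by (auto simp: P_def)
    moreover have "xs ! (r - 1) + (L - 1 - (r - 1)) \<in> beta_set xs"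
      using r1(1) unfolding beta_set_conv_nth L_def by blast
    then have "y \<noteq> xs ! (r - 1) + (L - 1 - (r - 1))" using y(1) by metis
    ultimately have "j < xs ! (r - 1)" using that r(2) Ly unfolding j_def by linarith
    also have "\<dots> \<le> xs ! k" using mono[of k "r - 1"] that r1(1) by simp
    finally show ?thesis .
  qed
  have "\<not> j < xs ! r" if "r < L"
    using r(1) that Ly unfolding P_def j_def by linarith
  then have "\<not> r < conj_part xs j" using less_conj_part_iff[OF p] L_def by blast
  moreover have "k < conj_part xs j" if "k < r" for k
    using less_conj_part_iff[OF p] big[OF that] that r(2) L_def by simp
  ultimately have "conj_part xs j = r" by (metis linorder_neqE_nat less_irrefl)
  then have yj: "y = j + (length xs - conj_part xs j)" using Ly r(2) by (simp add: j_def L_def)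
  moreover have "j < xs ! i"
  proof (rule ccontr)
    assume "\<not> j < xs ! i"
    then have "\<not> i < conj_part xs j" using less_conj_part_iff[OF p] by simp
    with \<open>\<not> j < xs ! i\<close> yj y(2) i show False by linarith
  qed
  ultimately show ?thesis using that by blast
qed

text \<open>A beta number x with x - t missing gives a hook of length exactly t. Conversely, a hook
  of length k t ends at a gap which k steps of size t inside the beta-set would reach.\<close>

lemma is_t_core_iff_beta_set:
  assumes "t > 0"
  shows "is_t_core t xs \<longleftrightarrow> is_partition xs \<and> (\<forall>x\<in>beta_set xs. t \<le> x \<longrightarrow> x - t \<in> beta_set xs)"
proof (cases "is_partition xs")
  case True
  have "(\<forall>i<length xs. \<forall>j<xs ! i. \<not> t dvd hook_length xs i j) \<longleftrightarrow> (\<forall>x\<in>beta_set xs. t \<le> x \<longrightarrow> x - t \<in> beta_set xs)"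
    (is "?L \<longleftrightarrow> ?R")
  proof
    assume L: ?L
    show ?R
    proof (intro ballI impI, rule ccontr)
      fix x assume x: "x \<in> beta_set xs" "t \<le> x" "x - t \<notin> beta_set xs"
      then obtain i where i: "i < length xs" "x = xs ! i + (length xs - 1 - i)" by (auto simp: beta_set_conv_nth)
      have "x - t < xs ! i + (length xs - 1 - i)" using i(2) x(2) assms by simp
      from gap_exists[OF True i(1) x(3) this]
      obtain j where j: "j < xs ! i" "x - t = j + (length xs - conj_part xs j)" .
      have "hook_length xs i j = t" using hook_length_eq[OF True i(1) j(1)] j(2) i(2) x(2) by simp
      then show False using L i(1) j(1) by (metis dvd_refl)
    qed
  next
    assume R: ?R
    have R': "x - k * t \<in> beta_set xs" if "x \<in> beta_set xs" "k * t \<le> x" for x k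
      using that(2)
    proof (induction k)
      case (Suc k)
      then have "x - k * t \<in> beta_set xs" "t \<le> x - k * t" by simp_all
      then have "x - k * t - t \<in> beta_set xs" using R by blast
      then show ?case by (simp add: add.commute)
    qed (simp add: that(1))
    show ?L
    proof (intro allI impI notI)
      fix i j assume ij: "i < length xs" "j < xs ! i" and "t dvd hook_length xs i j"
      then obtain k where k: "hook_length xs i j = t * k" by (elim dvdE)
      have "xs ! i + (length xs - 1 - i) \<in> beta_set xs" using ij(1) by (auto simp: beta_set_conv_nth)
      moreover note eq = hook_length_eq[OF True ij]
      ultimately have "xs ! i + (length xs - 1 - i) - k * t \<in> beta_set xs"
        by (intro R') (simp_all add: k mult.commute flip: eq)
      also have "xs ! i + (length xs - 1 - i) - k * t = j + (length xs - conj_part xs j)"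
        using eq unfolding k by (metis add_diff_cancel_left' mult.commute)
      finally show False using gap_notin_beta_set[OF True] by blast
    qed
  qed
  with True show ?thesis by (simp add: is_t_core_def)
qed (simp add: is_t_core_def)

text \<open>0 is never a first-column hook length, so closure under subtracting 3 empties the
  residue class 0; in the classes 1 and 2 it leaves initial segments, of lengths a and b.\<close>

definition core_beta_set :: "nat \<Rightarrow> nat \<Rightarrow> nat set" where
  "core_beta_set a b = (\<lambda>i. 3 * i + 1) ` {..<a} \<union> (\<lambda>i. 3 * i + 2) ` {..<b}"

lemma finite_core_beta_set [simp]: "finite (core_beta_set a b)"
  by (simp add: core_beta_set_def)

lemma core_beta_set_residues:
  "{i. 3 * i + 1 \<in> core_beta_set a b} = {..<a}" "{i. 3 * i + 2 \<in> core_beta_set a b} = {..<b}"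
  by (auto simp: core_beta_set_def) presburger+

lemma core_beta_set_inject: "core_beta_set a b = core_beta_set c d \<longleftrightarrow> a = c \<and> b = d"
  using core_beta_set_residues[of a b] core_beta_set_residues[of c d] by (metis lessThan_eq_iff)

lemma core_beta_set_disjoint: "(\<lambda>i::nat. 3 * i + 1) ` A \<inter> (\<lambda>i. 3 * i + 2) ` B = {}"
  by auto presburger

lemma inj_on_affine: "inj_on (\<lambda>i::nat. 3 * i + r) A"
  by (auto simp: inj_on_def)

lemma card_core_beta_set: "card (core_beta_set a b) = a + b"
  unfolding core_beta_set_def
  by (subst card_Un_disjoint[OF _ _ core_beta_set_disjoint])
    (simp_all only: card_image[OF inj_on_affine] card_lessThan finite_imageI finite_lessThan)

lemma sum_core_beta_set: "2 * \<Sum>(core_beta_set a b) + a = 3 * a\<^sup>2 + 3 * b\<^sup>2 + b"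
proof -
  have 1: "2 * (\<Sum>i<n. 3 * i + 1) + n = 3 * n\<^sup>2" for n :: nat
    by (induction n) (simp_all add: power2_eq_square algebra_simps)
  have 2: "2 * (\<Sum>i<n. 3 * i + 2) = 3 * n\<^sup>2 + n" for n :: nat
    by (induction n) (simp_all add: power2_eq_square algebra_simps)
  have "\<Sum>(core_beta_set a b) = (\<Sum>i<a. 3 * i + 1) + (\<Sum>i<b. 3 * i + 2)"
    unfolding core_beta_set_def
    by (subst sum.union_disjoint[OF _ _ core_beta_set_disjoint])
      (simp_all only: sum.reindex[OF inj_on_affine] finite_imageI finite_lessThan o_def)
  with 1[of a] 2[of b] show ?thesis by simp
qed

lemma downward_closed_nat:
  fixes D :: "nat set"
  assumes "finite D" "\<And>i. Suc i \<in> D \<Longrightarrow> i \<in> D"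
  obtains a where "D = {..<a}"
proof (cases "D = {}")
  case True
  then show ?thesis using that[of 0] by simp
next
  case False
  have "i \<in> D" if "i + k \<in> D" for i k
    using that by (induction k) (auto dest: assms(2))
  then have down: "i \<in> D" if "i \<le> j" "j \<in> D" for i j
    using that by (metis le_add_diff_inverse)
  have "Max D \<in> D" using False assms(1) by simp
  then have "D = {..<Suc (Max D)}"
    using assms(1) down[of _ "Max D"] by (auto simp: less_Suc_eq_le)
  then show ?thesis by (rule that)
qed

lemma closed_eq_core_beta_set:
  assumes X: "finite X" "0 \<notin> X" "\<And>x. x \<in> X \<Longrightarrow> 3 \<le> x \<Longrightarrow> x - 3 \<in> X"
  obtains a b where "X = core_beta_set a b"
proof -
  have *: "\<exists>a. {i. 3 * i + r \<in> X} = {..<a}" for r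
  proof -
    have "finite {i. 3 * i + r \<in> X}"
      using finite_vimageI[OF X(1), of "\<lambda>i. 3 * i + r"] inj_on_affine by (simp add: vimage_def)
    moreover have "3 * i + r \<in> X" if "3 * Suc i + r \<in> X" for i
      using X(3)[OF that] by simp
    ultimately show ?thesis using downward_closed_nat[of "{i. 3 * i + r \<in> X}"] by (metis mem_Collect_eq)
  qed
  obtain z where z: "{i. 3 * i + 0 \<in> X} = {..<z}" using * by blast
  have "0 \<notin> {..<z}" unfolding z[symmetric] using X(2) by simp
  then have "z = 0" by simp
  then have z0: "{i. 3 * i + 0 \<in> X} = {}" unfolding z by (simp only: lessThan_0)
  obtain a where a: "{i. 3 * i + 1 \<in> X} = {..<a}" using * by blast
  obtain b where b: "{i. 3 * i + 2 \<in> X} = {..<b}" using * by blast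
  have "x \<in> X \<longleftrightarrow> x \<in> core_beta_set a b" for x
  proof -
    have "x = 3 * (x div 3) + x mod 3" by simp
    moreover have "x mod 3 = 0 \<or> x mod 3 = 1 \<or> x mod 3 = 2" by presburger
    ultimately consider i where "x = 3 * i + 0" | i where "x = 3 * i + 1" | i where "x = 3 * i + 2" by metis
    then show ?thesis
    proof cases
      case 1
      then have "x \<notin> X" using z0 by blast
      moreover have "x \<notin> core_beta_set a b" using 1 by (auto simp: core_beta_set_def) presburger+
      ultimately show ?thesis by simp
    next
      case 2
      then show ?thesis using a core_beta_set_residues(1)[of a b] by blast
    next
      case 3
      then show ?thesis using b core_beta_set_residues(2)[of a b] by blast
    qed
  qed
  then show ?thesis using that by blast
qed

lemma is_3_core_iff: "is_t_core 3 xs \<longleftrightarrow> is_partition xs \<and> (\<exists>a b. beta_set xs = core_beta_set a b)"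
proof -
  have "(\<forall>x\<in>beta_set xs. 3 \<le> x \<longrightarrow> x - 3 \<in> beta_set xs) \<longleftrightarrow> (\<exists>a b. beta_set xs = core_beta_set a b)" if p: "is_partition xs"
  proof
    assume "\<forall>x\<in>beta_set xs. 3 \<le> x \<longrightarrow> x - 3 \<in> beta_set xs"
    then show "\<exists>a b. beta_set xs = core_beta_set a b"
      using closed_eq_core_beta_set[of "beta_set xs"] zero_notin_beta_set[OF p] by (metis finite_beta_set)
  next
    assume "\<exists>a b. beta_set xs = core_beta_set a b"
    then obtain a b where X: "beta_set xs = core_beta_set a b" by blast
    show "\<forall>x\<in>beta_set xs. 3 \<le> x \<longrightarrow> x - 3 \<in> beta_set xs"
    proof (intro ballI impI)
      fix x assume "x \<in> beta_set xs" "3 \<le> x"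
      then obtain i where "x = 3 * i + 1 \<and> i < a \<or> x = 3 * i + 2 \<and> i < b"
        unfolding X core_beta_set_def by auto
      moreover from this obtain k where "i = Suc k" using \<open>3 \<le> x\<close> by (cases i) auto
      ultimately have "x - 3 = 3 * k + 1 \<and> k < a \<or> x - 3 = 3 * k + 2 \<and> k < b" by auto
      then show "x - 3 \<in> beta_set xs" unfolding X core_beta_set_def by auto
    qed
  qed
  then show ?thesis by (auto simp: is_t_core_iff_beta_set)
qed

section \<open>Sizes of 3-cores and the norm form\<close>

definition cores :: "nat \<Rightarrow> nat list set" where
  "cores m = {xs. is_t_core 3 xs \<and> psize xs = m}"

definition core_pairs :: "nat \<Rightarrow> (nat \<times> nat) set" where
  "core_pairs m = {(a, b). (int a)\<^sup>2 - int a * int b + (int b)\<^sup>2 + int b = int m}"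

lemma psize_core_beta_set:
  assumes "is_partition xs" "beta_set xs = core_beta_set a b"
  shows "int (psize xs) = (int a)\<^sup>2 - int a * int b + (int b)\<^sup>2 + int b"
proof -
  have "length xs = a + b" using card_beta_set[OF assms(1)] by (simp add: assms(2) card_core_beta_set)
  then have "2 * \<Sum>(core_beta_set a b) + (a + b) = 2 * psize xs + (a + b) * (a + b)"
    using sum_beta_set[OF assms(1)] assms(2) by simp
  then have "int (2 * \<Sum>(core_beta_set a b) + a) + int b = int (2 * psize xs + (a + b) * (a + b))"
    by (simp flip: of_nat_add)
  then show ?thesis unfolding sum_core_beta_set by (simp add: power2_eq_square algebra_simps)
qed

lemma bij_betw_cores: "\<exists>f. bij_betw f (core_pairs m) (cores m)"
proof -
  define f where "f = (\<lambda>(a, b). THE xs. is_partition xs \<and> beta_set xs = core_beta_set a b)"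
  have f: "is_partition (f (a, b)) \<and> beta_set (f (a, b)) = core_beta_set a b" for a b
  proof -
    have "0 \<notin> core_beta_set a b" by (auto simp: core_beta_set_def)
    then have "\<exists>!xs. is_partition xs \<and> beta_set xs = core_beta_set a b"
      using beta_set_surj[of "core_beta_set a b"] beta_set_inject by (metis finite_core_beta_set)
    then show ?thesis unfolding f_def prod.case by (rule theI')
  qed
  have "bij_betw f (core_pairs m) (cores m)"
  proof (rule bij_betw_imageI)
    show "inj_on f (core_pairs m)"
    proof (rule inj_onI)
      fix s t assume "f s = f t"
      then have "core_beta_set (fst s) (snd s) = core_beta_set (fst t) (snd t)"
        using f[of "fst s" "snd s"] f[of "fst t" "snd t"] by simp
      then show "s = t" by (simp add: core_beta_set_inject prod_eq_iff)
    qed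
    show "f ` core_pairs m = cores m"
    proof (intro equalityI subsetI)
      fix xs assume "xs \<in> f ` core_pairs m"
      then obtain a b where ab: "(a, b) \<in> core_pairs m" "xs = f (a, b)" by auto
      then have "int (psize xs) = int m" using psize_core_beta_set f by (auto simp: core_pairs_def)
      then show "xs \<in> cores m" using f ab(2) unfolding cores_def is_3_core_iff by auto
    next
      fix xs assume xs: "xs \<in> cores m"
      then obtain a b where ab: "is_partition xs" "beta_set xs = core_beta_set a b"
        unfolding cores_def is_3_core_iff by blast
      then have "(a, b) \<in> core_pairs m" using psize_core_beta_set xs by (auto simp: core_pairs_def cores_def)
      moreover have "xs = f (a, b)" using beta_set_inject ab f by metis
      ultimately show "xs \<in> f ` core_pairs m" by blast
    qed
  qed
  then show ?thesis by blast
qed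

text \<open>The pair (a, b) corresponds to the vector (3 a + 1, 3 b + 2); rotating by the sixth roots of
  unity turns these vectors into all vectors of norm 9 m + 3.\<close>

lemma card_norm_reps_core_pairs: "finite (core_pairs m) \<and> card (norm_reps (9 * m + 3)) = 6 * card (core_pairs m)"
proof -
  let ?R = "norm_reps (9 * m + 3)"
  define B where "B = {(x, y) \<in> ?R. x mod 3 = 1}"
  define C where "C = {(x, y) \<in> ?R. x mod 3 = 2}"
  \<comment> \<open>Multiplication by w sends (x, y) to (-y, x - y) and keeps x = 1 mod 3. It
    permutes these three sectors, whose boundary lines contain no point of \<open>B\<close>;
    together with the negation that exchanges \<open>B\<close> and \<open>C\<close> this gives the
    factor 6.\<close>
  define B1 where "B1 = {(x, y) \<in> B. x > 0 \<and> y > 0}"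
  define B2 where "B2 = {(x, y) \<in> B. y < 0 \<and> y < x}"
  define B3 where "B3 = {(x, y) \<in> B. x < 0 \<and> x < y}"
  have norm: "x\<^sup>2 - x * y + y\<^sup>2 = 9 * int m + 3" if "(x, y) \<in> ?R" for x y
    using that by (simp add: norm_reps_def)
  have res: "(x + y) mod 3 = 0 \<and> x mod 3 \<noteq> 0" if "(x, y) \<in> ?R" for x y
  proof -
    have "(x + y)\<^sup>2 = 3 * (3 * int m + 1 + x * y)"
      using norm[OF that] by (simp add: power2_eq_square algebra_simps)
    then have "3 dvd (x + y)\<^sup>2" by simp
    then have s: "3 dvd x + y" by (simp add: prime_dvd_power_iff)
    moreover have "\<not> 3 dvd x"
    proof
      assume x: "3 dvd x"
      then have "3 dvd y" using s by (simp add: dvd_add_right_iff)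
      with x obtain a b where "x = 3 * a" "y = 3 * b" by (auto elim!: dvdE)
      then have "9 * (a\<^sup>2 - a * b + b\<^sup>2) = 9 * int m + 3"
        using norm[OF that] by (simp add: power2_eq_square algebra_simps)
      then show False by presburger
    qed
    ultimately show ?thesis by (simp add: dvd_eq_mod_eq_0)
  qed
  have rot: "(- y, x - y) \<in> B \<and> (y - x, - x) \<in> B" if "(x, y) \<in> B" for x y
  proof -
    have R: "(x, y) \<in> ?R" and x: "x mod 3 = 1" using that by (auto simp: B_def)
    have "(x + y) mod 3 = 0" using res[OF R] ..
    then have "- y mod 3 = 1" "(y - x) mod 3 = 1" using x by presburger+
    moreover note norm[OF R]
    ultimately show ?thesis by (simp add: B_def norm_reps_def power2_eq_square algebra_simps)
  qed
  have fin: "finite B" "finite C" 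
    by (rule finite_subset[OF _ finite_norm_reps[of "9 * m + 3"]], auto simp: B_def C_def)+
  then have fin': "finite B1" "finite B2" "finite B3"
    by (auto intro: finite_subset[of _ B] simp: B1_def B2_def B3_def)
  have "?R = B \<union> C"
  proof -
    have "x mod 3 = 1 \<or> x mod 3 = 2" if "(x, y) \<in> ?R" for x y
      using res[OF that] by presburger
    then show ?thesis unfolding B_def C_def by blast
  qed
  moreover have "B \<inter> C = {}" by (auto simp: B_def C_def)
  ultimately have 1: "card ?R = card B + card C" using fin by (simp add: card_Un_disjoint)
  have neg: "- x mod 3 = 2 \<longleftrightarrow> x mod 3 = 1" "- x mod 3 = 1 \<longleftrightarrow> x mod 3 = 2" for x :: int by presburger+
  have "bij_betw (\<lambda>(x, y). (- x, - y)) B C"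
    by (rule bij_betw_byWitness[where f' = "\<lambda>(x, y). (- x, - y)"])
      (auto simp: B_def C_def norm_reps_def neg)
  then have 2: "card C = card B" by (simp add: bij_betw_same_card)
  have "B = B1 \<union> B2 \<union> B3"
  proof -
    have "x \<noteq> 0 \<and> y \<noteq> 0 \<and> x \<noteq> y" if "(x, y) \<in> B" for x y
    proof -
      have R: "(x, y) \<in> ?R" and x: "x mod 3 = 1" using that by (auto simp: B_def)
      have "(x + y) mod 3 = 0" using res[OF R] ..
      with x show ?thesis by presburger
    qed
    then show ?thesis unfolding B1_def B2_def B3_def by fastforce
  qed
  moreover have "B1 \<inter> B2 = {}" "(B1 \<union> B2) \<inter> B3 = {}" by (auto simp: B1_def B2_def B3_def)
  ultimately have 3: "card B = card B1 + card B2 + card B3" using fin' by (simp add: card_Un_disjoint)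
  have "bij_betw (\<lambda>(x, y). (- y, x - y)) B2 B1"
    by (rule bij_betw_byWitness[where f' = "\<lambda>(x, y). (y - x, - x)"])
      (use rot in \<open>auto simp: B1_def B2_def\<close>)
  then have 4: "card B2 = card B1" by (rule bij_betw_same_card)
  have "bij_betw (\<lambda>(x, y). (y - x, - x)) B3 B1"
    by (rule bij_betw_byWitness[where f' = "\<lambda>(x, y). (- y, x - y)"])
      (use rot in \<open>auto simp: B1_def B3_def\<close>)
  then have 5: "card B3 = card B1" by (rule bij_betw_same_card)
  have norm': "(3 * int a + 1)\<^sup>2 - (3 * int a + 1) * (3 * int b + 2) + (3 * int b + 2)\<^sup>2
      = 9 * ((int a)\<^sup>2 - int a * int b + (int b)\<^sup>2 + int b) + 3" for a b
    by (simp add: power2_eq_square algebra_simps)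
  have bij: "bij_betw (\<lambda>(a, b). (3 * int a + 1, 3 * int b + 2)) (core_pairs m) B1"
  proof (rule bij_betw_imageI)
    show "inj_on (\<lambda>(a, b). (3 * int a + 1, 3 * int b + 2)) (core_pairs m)" by (auto simp: inj_on_def)
    show "(\<lambda>(a, b). (3 * int a + 1, 3 * int b + 2)) ` core_pairs m = B1"
    proof (intro equalityI subsetI)
      fix t assume "t \<in> (\<lambda>(a, b). (3 * int a + 1, 3 * int b + 2)) ` core_pairs m"
      then obtain a b where "(a, b) \<in> core_pairs m" "t = (3 * int a + 1, 3 * int b + 2)" by auto
      then show "t \<in> B1" using norm'[of a b] by (auto simp: core_pairs_def B1_def B_def norm_reps_def)
    next
      fix t assume "t \<in> B1"
      then obtain x y where t: "t = (x, y)" "(x, y) \<in> ?R" "x mod 3 = 1" "x > 0" "y > 0"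
        by (auto simp: B1_def B_def)
      define a where "a = nat (x div 3)"
      define b where "b = nat (y div 3)"
      have "y mod 3 = 2" using res[OF t(2)] t(3) by presburger
      moreover have "int a = x div 3" "int b = y div 3"
        using t(4,5) by (simp_all add: a_def b_def)
      ultimately have xy: "x = 3 * int a + 1" "y = 3 * int b + 2"
        using t(3) by presburger+
      have "9 * ((int a)\<^sup>2 - int a * int b + (int b)\<^sup>2 + int b) + 3 = 9 * int m + 3"
        using norm[OF t(2)] unfolding xy norm' .
      then have "(a, b) \<in> core_pairs m" unfolding core_pairs_def by simp
      then show "t \<in> (\<lambda>(a, b). (3 * int a + 1, 3 * int b + 2)) ` core_pairs m"
        using xy t(1) by force
    qed
  qed
  then have "card (core_pairs m) = card B1" "finite (core_pairs m)"
    using fin'(1) by (auto simp: bij_betw_same_card bij_betw_finite)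
  with 1 2 3 4 5 show ?thesis by simp
qed

text \<open>9 m + 3 is 3 (3 m + 1), and the ramified factor 3 does not change the number of
  representations.\<close>

lemma card_cores: "finite (cores m)" "int (card (cores m)) = divisor_sum chi (\<lambda>_. 1) (3 * m + 1)"
proof -
  obtain f where f: "bij_betw f (core_pairs m) (cores m)" using bij_betw_cores by blast
  then show "finite (cores m)" using card_norm_reps_core_pairs bij_betw_finite by blast
  have "6 * card (cores m) = card (norm_reps (3 * (3 * m + 1)))"
    using bij_betw_same_card[OF f] card_norm_reps_core_pairs[of m] by (simp add: algebra_simps)
  also have "\<dots> = card (norm_reps (3 * m + 1))" by (rule card_norm_reps_mult_3)
  finally have "6 * int (card (cores m)) = int (card (norm_reps (3 * m + 1)))" by (metis of_nat_mult of_nat_numeral)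
  then show "int (card (cores m)) = divisor_sum chi (\<lambda>_. 1) (3 * m + 1)" by (simp add: card_norm_reps)
qed

section \<open>Triples of 3-cores\<close>

lemma sum_hyp_divisors:
  assumes "N > 0"
  shows "(\<Sum>(c, x)\<in>hyp (int N). f c x)
    = (\<Sum>d | d dvd N. f (int d) (int (N div d)) + f (- int d) (- int (N div d)))"
proof -
  define P where "P = (\<lambda>d. (int d, int (N div d))) ` {d. d dvd N}"
  define Q where "Q = (\<lambda>d. (- int d, - int (N div d))) ` {d. d dvd N}"
  have fin: "finite {d. d dvd N}" using assms by simp
  have "hyp (int N) = P \<union> Q"
  proof (intro equalityI subsetI)
    fix t assume "t \<in> hyp (int N)"
    then obtain c x where t: "t = (c, x)" "c * x = int N" by (auto simp: hyp_def)
    have "int (nat \<bar>c\<bar> * nat \<bar>x\<bar>) = int N" using t(2) by (simp flip: abs_mult)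
    then have *: "nat \<bar>c\<bar> * nat \<bar>x\<bar> = N" by (simp only: of_nat_eq_iff)
    then have "nat \<bar>c\<bar> \<noteq> 0" using assms by (metis mult_is_0 less_irrefl)
    with * have div: "N div nat \<bar>c\<bar> = nat \<bar>x\<bar>" by (metis nonzero_mult_div_cancel_left)
    have dvd: "nat \<bar>c\<bar> dvd N" using * by (metis dvd_triv_left)
    have "c * x > 0" using t(2) assms by simp
    then have "c > 0 \<and> x > 0 \<or> c < 0 \<and> x < 0" by (auto simp: zero_less_mult_iff)
    then have "t = (int (nat \<bar>c\<bar>), int (N div nat \<bar>c\<bar>)) \<or> t = (- int (nat \<bar>c\<bar>), - int (N div nat \<bar>c\<bar>))"
      unfolding div t by auto
    then show "t \<in> P \<union> Q" using dvd unfolding P_def Q_def by blast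
  next
    have "(int d, int (N div d)) \<in> hyp (int N)" "(- int d, - int (N div d)) \<in> hyp (int N)" if "d dvd N" for d
      using that by (simp_all add: hyp_def flip: of_nat_mult)
    then show "t \<in> hyp (int N)" if "t \<in> P \<union> Q" for t using that unfolding P_def Q_def by blast
  qed
  moreover have "P \<inter> Q = {}"
  proof -
    have "int d \<noteq> - int e" if "d dvd N" for d e
      using that assms by (cases "d = 0") auto
    then show ?thesis unfolding P_def Q_def by blast
  qed
  ultimately have "(\<Sum>(c, x)\<in>hyp (int N). f c x) = (\<Sum>(c, x)\<in>P. f c x) + (\<Sum>(c, x)\<in>Q. f c x)"
    using fin by (simp add: P_def Q_def sum.union_disjoint)
  also have "(\<Sum>(c, x)\<in>P. f c x) = (\<Sum>d | d dvd N. f (int d) (int (N div d)))"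
    unfolding P_def by (subst sum.reindex) (auto simp: inj_on_def)
  also have "(\<Sum>(c, x)\<in>Q. f c x) = (\<Sum>d | d dvd N. f (- int d) (- int (N div d)))"
    unfolding Q_def by (subst sum.reindex) (auto simp: inj_on_def)
  finally show ?thesis by (simp add: sum.distrib)
qed

definition core_weight :: "int \<Rightarrow> int" where
  "core_weight M = (\<Sum>(c, x)\<in>hyp M. if c mod 3 = 1 \<and> x mod 3 = 1 then sgn c else 0)"

lemma neg_int_mod_3: "(- int d) mod 3 = 1 \<longleftrightarrow> d mod 3 = 2" "int d mod 3 = 1 \<longleftrightarrow> d mod 3 = 1"
  by presburger+

text \<open>A divisor d of 3 m + 1 and its cofactor have equal residues modulo 3, so exactly one of
  d and -d gives a factorization in the class (1, 1), and its sign is \<open>chi d\<close>.\<close>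

lemma card_cores_eq: "int (card (cores m)) = core_weight (3 * int m + 1)"
proof -
  have "core_weight (int (3 * m + 1)) = (\<Sum>d | d dvd 3 * m + 1. chi d * 1)"
    unfolding core_weight_def
  proof (subst sum_hyp_divisors)
    show "(\<Sum>d | d dvd 3 * m + 1.
       (if int d mod 3 = 1 \<and> int ((3 * m + 1) div d) mod 3 = 1 then sgn (int d) else 0) +
       (if - int d mod 3 = 1 \<and> - int ((3 * m + 1) div d) mod 3 = 1 then sgn (- int d) else 0))
      = (\<Sum>d | d dvd 3 * m + 1. chi d * 1)"
    proof (rule sum.cong[OF refl])
      fix d assume "d \<in> {d. d dvd 3 * m + 1}"
      then have "d * ((3 * m + 1) div d) = 3 * m + 1" by simp
      moreover have "chi (3 * m + 1) = 1" unfolding chi_def by presburger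
      ultimately have "chi d * chi ((3 * m + 1) div d) = 1" by (metis chi_mult)
      then have "(d mod 3 = 1 \<and> (3 * m + 1) div d mod 3 = 1) \<or> (d mod 3 = 2 \<and> (3 * m + 1) div d mod 3 = 2)"
        by (auto simp: chi_def split: if_splits)
      moreover from this have "d > 0" by (cases d) auto
      ultimately show "(if int d mod 3 = 1 \<and> int ((3 * m + 1) div d) mod 3 = 1 then sgn (int d) else 0) +
       (if - int d mod 3 = 1 \<and> - int ((3 * m + 1) div d) mod 3 = 1 then sgn (- int d) else 0) = chi d * 1"
        unfolding neg_int_mod_3 by (auto simp: chi_def)
    qed
  qed simp
  then show ?thesis by (simp add: card_cores divisor_sum_def add.commute)
qed

lemma core_weight_eq_0: "m mod 3 \<noteq> 1 \<Longrightarrow> core_weight m = 0"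
proof -
  assume m: "m mod 3 \<noteq> 1"
  have "\<not> (c mod 3 = 1 \<and> x mod 3 = 1)" if "(c, x) \<in> hyp m" for c x
  proof
    assume "c mod 3 = 1 \<and> x mod 3 = 1"
    then have "(c * x) mod 3 = 1" by (subst mod_mult_eq[symmetric]) simp
    with m that show False by (simp add: hyp_def)
  qed
  then show ?thesis unfolding core_weight_def by (intro sum.neutral) auto
qed

text \<open>Passes between sums over core sizes and sums over all positive integers below M. The
  range of M covers both uses, 3 k + 2 for pairs and 3 k + 3 for triples.\<close>

lemma sum_residue_1:
  fixes f :: "int \<Rightarrow> int"
  assumes f: "\<And>m. m mod 3 \<noteq> 1 \<Longrightarrow> f m = 0" and M: "3 * int k + 1 < M" "M \<le> 3 * int k + 4"
  shows "(\<Sum>m\<in>{0<..<M}. f m) = (\<Sum>j\<le>k. f (3 * int j + 1))"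
proof -
  have "(\<Sum>m\<in>{0<..<M}. f m) = (\<Sum>m\<in>(\<lambda>j. 3 * int j + 1) ` {..k}. f m)"
  proof (rule sum.mono_neutral_right)
    show "(\<lambda>j. 3 * int j + 1) ` {..k} \<subseteq> {0<..<M}" using M by auto
    show "\<forall>m\<in>{0<..<M} - (\<lambda>j. 3 * int j + 1) ` {..k}. f m = 0"
    proof
      fix m assume m: "m \<in> {0<..<M} - (\<lambda>j. 3 * int j + 1) ` {..k}"
      have "m \<in> (\<lambda>j. 3 * int j + 1) ` {..k}" if "m mod 3 = 1"
      proof -
        have "m = 3 * (m div 3) + 1" using that by presburger
        moreover have "m div 3 = int (nat (m div 3))" using m by simp
        ultimately obtain j where j: "m = 3 * int j + 1" by metis
        then have "j \<le> k" using m M by simp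
        with j show ?thesis by blast
      qed
      then show "f m = 0" using m f by blast
    qed
  qed auto
  also have "\<dots> = (\<Sum>j\<le>k. f (3 * int j + 1))"
    by (subst sum.reindex) (auto simp: inj_on_def)
  finally show ?thesis .
qed

text \<open>Groups the solutions by the value m = a x; the restriction to 0 < m < M is the
  positivity of both products.\<close>

lemma sum_quad_convolution:
  fixes F H :: "int \<Rightarrow> int \<Rightarrow> int"
  shows "(\<Sum>(a, b, x, y)\<in>quad M. F a x * H b y)
    = (\<Sum>m\<in>{0<..<M}. (\<Sum>(c, x)\<in>hyp m. F c x) * (\<Sum>(c, x)\<in>hyp (M - m). H c x))"
proof -
  have "(\<Sum>m\<in>{0<..<M}. (\<Sum>(c, x)\<in>hyp m. F c x) * (\<Sum>(c, x)\<in>hyp (M - m). H c x))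
      = (\<Sum>m\<in>{0<..<M}. \<Sum>(s, t)\<in>hyp m \<times> hyp (M - m). F (fst s) (snd s) * H (fst t) (snd t))"
    by (simp only: case_prod_unfold sum_product sum.cartesian_product' fst_conv snd_conv)
  also have "\<dots> = (\<Sum>(m, s, t)\<in>Sigma {0<..<M} (\<lambda>m. hyp m \<times> hyp (M - m)). F (fst s) (snd s) * H (fst t) (snd t))"
    by (subst sum.Sigma) (auto simp: case_prod_unfold)
  also have "\<dots> = (\<Sum>(a, b, x, y)\<in>quad M. F a x * H b y)"
    by (rule sum.reindex_bij_witness[where i = "\<lambda>(a, b, x, y). (a * x, (a, x), (b, y))"
          and j = "\<lambda>(m, s, t). (fst s, fst t, snd s, snd t)"])
      (auto simp: quad_def hyp_def)
  finally show ?thesis by simp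
qed

lemma sum_cores_2:
  "3 * (\<Sum>j\<le>k. int (card (cores j)) * int (card (cores (k - j))))
    = (\<Sum>(c, x)\<in>hyp (3 * int k + 2). if c mod 3 = 2 \<and> x mod 3 = 1 then \<bar>c\<bar> else 0)"
proof -
  let ?M = "3 * int k + 2"
  let ?F = "\<lambda>a x. if a mod 3 = 1 \<and> x mod 3 = 1 then sgn a else 0 :: int"
  have "(\<Sum>j\<le>k. int (card (cores j)) * int (card (cores (k - j))))
      = (\<Sum>j\<le>k. core_weight (3 * int j + 1) * core_weight (?M - (3 * int j + 1)))"
    by (rule sum.cong) (auto simp: card_cores_eq of_nat_diff algebra_simps)
  also have "\<dots> = (\<Sum>m\<in>{0<..<?M}. core_weight m * core_weight (?M - m))"
    by (rule sum_residue_1[symmetric]) (auto simp: core_weight_eq_0)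
  also have "\<dots> = (\<Sum>(a, b, x, y)\<in>quad ?M. ?F a x * ?F b y)"
    unfolding core_weight_def by (rule sum_quad_convolution[symmetric])
  also have "\<dots> = (\<Sum>(a, b, x, y)\<in>quad ?M. sgn a * sgn b * (if a mod 3 = 1 \<and> b mod 3 = 1 \<and> x mod 3 = 1 \<and> y mod 3 = 1 then 1 else 0))"
    by (rule sum_quad_cong) auto
  finally show ?thesis using quad_weight_2[of ?M] by simp
qed

text \<open>One core of size i has parameter 3 i + 1 and the remaining pair 3 (n - i) + 2, with
  total 3 (n + 1). Since |b| = sgn b * b, the pair sum supplies the weight b of
  \<open>quad_weight_3\<close>, and the factors 3 from the two evaluations cancel.\<close>

lemma sum_cores_3:
  "(\<Sum>i\<le>n. int (card (cores i)) * (\<Sum>j\<le>n - i. int (card (cores j)) * int (card (cores (n - i - j)))))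
    = divisor_sum (\<lambda>d. (int d)\<^sup>2) chi (n + 1)"
    (is "?L = _")
proof -
  let ?N = "int (n + 1)"
  let ?M = "3 * ?N"
  let ?F = "\<lambda>a x. if a mod 3 = 1 \<and> x mod 3 = 1 then sgn a else 0 :: int"
  let ?H = "\<lambda>b y. if b mod 3 = 2 \<and> y mod 3 = 1 then \<bar>b\<bar> else 0 :: int"
  have "3 * ?L = (\<Sum>i\<le>n. int (card (cores i)) * (3 * (\<Sum>j\<le>n - i. int (card (cores j)) * int (card (cores (n - i - j))))))"
    by (simp add: sum_distrib_left mult.left_commute)
  also have "\<dots> = (\<Sum>i\<le>n. core_weight (3 * int i + 1) * (\<Sum>(c, x)\<in>hyp (?M - (3 * int i + 1)). ?H c x))"
    unfolding sum_cores_2 by (rule sum.cong) (auto simp: card_cores_eq of_nat_diff algebra_simps)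
  also have "\<dots> = (\<Sum>m\<in>{0<..<?M}. core_weight m * (\<Sum>(c, x)\<in>hyp (?M - m). ?H c x))"
    by (rule sum_residue_1[symmetric]) (auto simp: core_weight_eq_0)
  also have "\<dots> = (\<Sum>(a, b, x, y)\<in>quad ?M. ?F a x * ?H b y)"
    unfolding core_weight_def by (rule sum_quad_convolution[symmetric])
  also have "\<dots> = (\<Sum>(a, b, x, y)\<in>quad ?M. sgn a * sgn b * (if a mod 3 = 1 \<and> b mod 3 = 2 \<and> x mod 3 = 1 \<and> y mod 3 = 1 then b else 0))"
    by (rule sum_quad_cong) (auto simp: abs_sgn mult.commute)
  also have "\<dots> = 3 * (\<Sum>(c, x)\<in>hyp ?N. if x mod 3 = 1 then sgn c * c\<^sup>2 else 0)"
    by (rule quad_weight_3) simp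
  also have "(\<Sum>(c, x)\<in>hyp ?N. if x mod 3 = 1 then sgn c * c\<^sup>2 else 0) = divisor_sum (\<lambda>d. (int d)\<^sup>2) chi (n + 1)"
    unfolding divisor_sum_def
  proof (subst sum_hyp_divisors)
    show "(\<Sum>d | d dvd n + 1.
       (if int ((n + 1) div d) mod 3 = 1 then sgn (int d) * (int d)\<^sup>2 else 0) +
       (if - int ((n + 1) div d) mod 3 = 1 then sgn (- int d) * (- int d)\<^sup>2 else 0))
      = (\<Sum>d | d dvd n + 1. (int d)\<^sup>2 * chi ((n + 1) div d))"
    proof (rule sum.cong[OF refl])
      fix d assume "d \<in> {d. d dvd n + 1}"
      then have "d > 0" by (cases d) auto
      then show "(if int ((n + 1) div d) mod 3 = 1 then sgn (int d) * (int d)\<^sup>2 else 0) +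
       (if - int ((n + 1) div d) mod 3 = 1 then sgn (- int d) * (- int d)\<^sup>2 else 0) = (int d)\<^sup>2 * chi ((n + 1) div d)"
        unfolding neg_int_mod_3 by (auto simp: chi_def)
    qed
  qed simp
  finally show ?thesis by simp
qed

section \<open>The divisor formula for B3 and its values along prime powers\<close>

lemma B3_eq_sum_cores:
  "B3 n = (\<Sum>i\<le>n. card (cores i) * (\<Sum>j\<le>n - i. card (cores j) * card (cores (n - i - j))))"
proof -
  define T where "T = Sigma {..n} (\<lambda>i. cores i \<times> Sigma {..n - i} (\<lambda>j. cores j \<times> cores (n - i - j)))"
  have "bij_betw (\<lambda>(i, a, j, b, c). (a, b, c)) T
     {(a, b, c). is_t_core 3 a \<and> is_t_core 3 b \<and> is_t_core 3 c \<and> psize a + psize b + psize c = n}"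
    by (rule bij_betw_byWitness[where f' = "\<lambda>(a, b, c). (psize a, a, psize b, b, c)"])
      (auto simp: T_def cores_def)
  then have "B3 n = card T" unfolding B3_def by (simp add: bij_betw_same_card)
  also have "\<dots> = (\<Sum>i\<le>n. card (cores i) * (\<Sum>j\<le>n - i. card (cores j) * card (cores (n - i - j))))"
    unfolding T_def by (simp add: card_SigmaI card_cores card_cartesian_product)
  finally show ?thesis .
qed

lemma B3_eq_divisor_sum: "int (B3 n) = divisor_sum (\<lambda>d. (int d)\<^sup>2) chi (n + 1)"
  unfolding B3_eq_sum_cores sum_cores_3[symmetric] by simp

text \<open>Solves the second-order recursion whose characteristic roots are \<open>f p\<close> and
  \<open>g p\<close>. As p does not divide N, the first step has no subtracted term. Multiplying by
  the difference of the roots keeps the statement in the integers.\<close>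

lemma divisor_sum_prime_power_mult:
  fixes f g :: "nat \<Rightarrow> int"
  assumes f: "\<And>m n. f (m * n) = f m * f n" and g: "\<And>m n. g (m * n) = g m * g n"
    and p: "prime p" and N: "N > 0" "\<not> p dvd N"
  shows "(f p - g p) * divisor_sum f g (p ^ k * N) = (f p ^ Suc k - g p ^ Suc k) * divisor_sum f g N"
proof (induction k rule: less_induct)
  case (less k)
  have p0: "p > 0" using p prime_gt_0_nat by blast
  note rec = divisor_sum_prime_mult[OF f g p]
  consider "k = 0" | "k = 1" | j where "k = Suc (Suc j)"
    by (metis One_nat_def not0_implies_Suc)
  then show ?case
  proof cases
    case 1
    then show ?thesis by simp
  next
    case 2
    then show ?thesis using rec[OF N(1)] N(2) by (simp add: algebra_simps)
  next
    case 3
    have "divisor_sum f g (p ^ k * N) = (f p + g p) * divisor_sum f g (p ^ Suc j * N) - f p * g p * divisor_sum f g (p ^ j * N)"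
      using rec[of "p ^ Suc j * N"] N(1) p0 by (simp add: 3 mult.assoc)
    then have "(f p - g p) * divisor_sum f g (p ^ k * N)
      = (f p - g p) * ((f p + g p) * divisor_sum f g (p ^ Suc j * N) - f p * g p * divisor_sum f g (p ^ j * N))" by simp
    also have "\<dots> = (f p + g p) * ((f p - g p) * divisor_sum f g (p ^ Suc j * N)) - f p * g p * ((f p - g p) * divisor_sum f g (p ^ j * N))"
      by (simp add: algebra_simps)
    also have "\<dots> = (f p ^ Suc k - g p ^ Suc k) * divisor_sum f g N"
    proof -
      have "Suc j < k" "j < k" using 3 by simp_all
      note IH = this[THEN less.IH]
      show ?thesis unfolding IH 3 by (simp add: algebra_simps)
    qed
    finally show ?thesis .
  qed
qed

lemma B3_prime_power:
  assumes p: "prime p" "\<not> p dvd n + 1"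
  shows "((real p)\<^sup>2 - of_int (chi p)) * real (B3 (p ^ k * n + p ^ k - 1))
    = (real p ^ (2 * (k + 1)) - of_int (chi p) ^ (k + 1)) * real (B3 n)"
proof -
  have "p ^ k > 0" using p(1) prime_gt_0_nat by simp
  \<comment> \<open>The shift from n to n + 1 in the divisor formula is what makes the argument of
    B3 purely multiplicative.\<close>
  then have "p ^ k * n + p ^ k - 1 + 1 = p ^ k * (n + 1)" by simp
  moreover have "((int p)\<^sup>2 - chi p) * divisor_sum (\<lambda>d. (int d)\<^sup>2) chi (p ^ k * (n + 1))
      = (((int p)\<^sup>2) ^ Suc k - chi p ^ Suc k) * divisor_sum (\<lambda>d. (int d)\<^sup>2) chi (n + 1)"
    by (rule divisor_sum_prime_power_mult) (use p in \<open>simp_all add: chi_mult power_mult_distrib\<close>)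
  ultimately have "((int p)\<^sup>2 - chi p) * int (B3 (p ^ k * n + p ^ k - 1)) = (((int p)\<^sup>2) ^ Suc k - chi p ^ Suc k) * int (B3 n)"
    unfolding B3_eq_divisor_sum by metis
  then have "real_of_int (((int p)\<^sup>2 - chi p) * int (B3 (p ^ k * n + p ^ k - 1)))
    = real_of_int ((((int p)\<^sup>2) ^ Suc k - chi p ^ Suc k) * int (B3 n))" by (simp only:)
  moreover have "real p ^ (2 * (k + 1)) = ((real p)\<^sup>2) ^ Suc k" unfolding power_mult by simp
  ultimately show ?thesis by simp
qed

text \<open>Since \<open>chi 3\<close> is 0, the recursion at 3 is of first order and each factor 3
  multiplies by 9, whether or not 3 divides n + 1.\<close>

lemma B3_power_3: "B3 (3 ^ k * n + 3 ^ k - 1) = 3 ^ (2 * k) * B3 n"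
proof -
  let ?E = "divisor_sum (\<lambda>d. (int d)\<^sup>2) chi"
  have chi3: "chi 3 = 0" by (simp add: chi_def)
  have step: "?E (3 * N) = 9 * ?E N" if "N > 0" for N
    using that by (subst divisor_sum_prime_mult) (auto simp: chi_mult chi3 power_mult_distrib)
  have "?E (3 ^ k * (n + 1)) = 9 ^ k * ?E (n + 1)"
    by (induction k) (simp_all add: step mult.assoc del: add_Suc_right)
  moreover have "3 ^ k * n + 3 ^ k - 1 + 1 = 3 ^ k * (n + 1)" by simp
  ultimately have "int (B3 (3 ^ k * n + 3 ^ k - 1)) = int (9 ^ k * B3 n)"
    unfolding of_nat_mult B3_eq_divisor_sum by (simp only: of_nat_power of_nat_numeral)
  then show ?thesis by (simp only: of_nat_eq_iff) (simp add: power_mult)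
qed

theorem theorem3p4:
  fixes p k n :: nat
  assumes "prime p"
  shows "(p = 3 \<longrightarrow> B3 (3^k * n + 3^k - 1) = 3^(2*k) * B3 n)
       \<and> (p mod 3 = 1 \<and> \<not> p dvd (n + 1) \<longrightarrow>
            real (B3 (p^k * n + p^k - 1))
              = (real p ^ (2*(k+1)) - 1) / (real p ^ 2 - 1) * real (B3 n))
       \<and> (p mod 3 = 2 \<and> \<not> p dvd (n + 1) \<longrightarrow>
            real (B3 (p^k * n + p^k - 1))
              = (real p ^ (2*(k+1)) + (-1) ^ k) / (real p ^ 2 + 1) * real (B3 n))"
proof (intro conjI impI; (elim conjE)?)
  show "B3 (3^k * n + 3^k - 1) = 3^(2*k) * B3 n" by (rule B3_power_3)
next
  assume p: "p mod 3 = 1" "\<not> p dvd (n + 1)"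
  have "real p > 1" using assms prime_gt_1_nat by simp
  then have "real p ^ 2 > 1" by (simp add: one_less_power)
  moreover have "chi p = 1" using p(1) by (simp add: chi_def)
  ultimately show "real (B3 (p^k * n + p^k - 1)) = (real p ^ (2*(k+1)) - 1) / (real p ^ 2 - 1) * real (B3 n)"
    using B3_prime_power[OF assms p(2), of k] by (simp add: field_simps)
next
  assume p: "p mod 3 = 2" "\<not> p dvd (n + 1)"
  have "real p ^ 2 + 1 > 0" by (simp add: add_nonneg_pos)
  moreover have "chi p = -1" using p(1) by (simp add: chi_def)
  ultimately show "real (B3 (p^k * n + p^k - 1)) = (real p ^ (2*(k+1)) + (-1) ^ k) / (real p ^ 2 + 1) * real (B3 n)"
    using B3_prime_power[OF assms p(2), of k] by (simp add: field_simps)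
qed

end
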